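(* Let $G$ be a $2$-connected outerplanar graph with $n$ vertices and maximum degree $\Delta(G)=5$. Then $\chi'_{st}(G)\le \lfloor 1.5\Delta\rfloor+2=\Delta+4=9$.
   Context: A star edge coloring of a graph $G$ is a proper edge coloring of $G$ in which no path or cycle with four edges is bichromatic. The star chromatic index $\chi'_{st}(G)$ is the minimum number of colors in a star edge coloring of $G$. An outerplanar graph is a graph drawable in the plane without crossings with all vertices on the outer face. *)

theory Defs
  imports "HOL-Analysis.Analysis"
begin

definition simple_graph :: "'a set \<Rightarrow> 'a set set \<Rightarrow> bool" where
  "simple_graph V E \<longleftrightarrow> finite V \<and> (\<forall>e\<in>E. e \<subseteq> V \<and> card e = 2)"

definition degree :: "'a set set \<Rightarrow> 'a \<Rightarrow> nat" where
  "degree E v = card {e\<in>E. v \<in> e}"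

definition max_degree :: "'a set \<Rightarrow> 'a set set \<Rightarrow> nat" where
  "max_degree V E = Max (degree E ` V)"

definition connected_on :: "'a set set \<Rightarrow> 'a set \<Rightarrow> bool" where
  "connected_on E S \<longleftrightarrow> S \<noteq> {} \<and>
     (\<forall>u\<in>S. \<forall>v\<in>S. (\<lambda>x y. x \<in> S \<and> y \<in> S \<and> {x, y} \<in> E)\<^sup>*\<^sup>* u v)"

definition two_connected :: "'a set \<Rightarrow> 'a set set \<Rightarrow> bool" where
  "two_connected V E \<longleftrightarrow> card V \<ge> 3 \<and> connected_on E V \<and>
     (\<forall>v\<in>V. connected_on E (V - {v}))"

definition outerplanar_drawing ::
  "'a set \<Rightarrow> 'a set set \<Rightarrow> ('a \<Rightarrow> complex) \<Rightarrow> ('a set \<Rightarrow> real \<Rightarrow> complex) \<Rightarrow> bool" where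
  "outerplanar_drawing V E p \<gamma> \<longleftrightarrow>
     inj_on p V \<and>
     (\<forall>e\<in>E. arc (\<gamma> e) \<and>
        (\<exists>u v. e = {u, v} \<and> pathstart (\<gamma> e) = p u \<and> pathfinish (\<gamma> e) = p v) \<and>
        path_image (\<gamma> e) \<inter> p ` V = p ` e) \<and>
     (\<forall>e\<in>E. \<forall>f\<in>E. e \<noteq> f \<longrightarrow> path_image (\<gamma> e) \<inter> path_image (\<gamma> f) \<subseteq> p ` (e \<inter> f)) \<and>
     (\<forall>v\<in>V. p v \<in> closure (outside (p ` V \<union> (\<Union>e\<in>E. path_image (\<gamma> e)))))"

definition outerplanar :: "'a set \<Rightarrow> 'a set set \<Rightarrow> bool" where
  "outerplanar V E \<longleftrightarrow> (\<exists>p \<gamma>. outerplanar_drawing V E p \<gamma>)"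

text \<open>Star edge colouring: proper, and no path or cycle with four edges is bichromatic.
  A walk v0..v4 with v0..v3 distinct and v1..v4 distinct is exactly a path with four
  edges (v0 \<noteq> v4) or a cycle with four edges (v0 = v4).\<close>
definition star_edge_coloring :: "'a set set \<Rightarrow> ('a set \<Rightarrow> nat) \<Rightarrow> bool" where
  "star_edge_coloring E c \<longleftrightarrow>
     (\<forall>e\<in>E. \<forall>f\<in>E. e \<noteq> f \<and> e \<inter> f \<noteq> {} \<longrightarrow> c e \<noteq> c f) \<and>
     (\<forall>v0 v1 v2 v3 v4. {v0, v1} \<in> E \<and> {v1, v2} \<in> E \<and> {v2, v3} \<in> E \<and> {v3, v4} \<in> E \<and>
        distinct [v0, v1, v2, v3] \<and> distinct [v1, v2, v3, v4] \<longrightarrow>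
        card {c {v0, v1}, c {v1, v2}, c {v2, v3}, c {v3, v4}} > 2)"

definition star_chromatic_index :: "'a set set \<Rightarrow> nat" where
  "star_chromatic_index E =
     (LEAST k. \<exists>c :: 'a set \<Rightarrow> nat. star_edge_coloring E c \<and> card (c ` E) \<le> k)"

end

(* A longest cycle of a 2-connected outerplanar graph is Hamiltonian and its chords do not cross:
   otherwise some vertex would lie inside a closed curve of the drawing. So the vertices can be
   numbered along a Hamiltonian cycle.

   A proper edge colouring is a star edge colouring iff for any two neighbours x, y of any vertex u,
   the colour of uy is missing at x or the colour of ux is missing at y. Give every vertex a palette
   of five of the nine colours, its edges using distinct places of the palette modulo 5, and demand
   that the neighbour along place i has none of the colours at the places i + 1 and i + 3. As
   {1, 3} and {-1, -3} partition the nonzero residues modulo 5, this settles every pair x, y.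

   Such palettes are chosen one vertex at a time. The vertices still without palette form gaps
   between consecutive treated vertices u < v, and by planarity the largest neighbour w of u in its
   gap splits it into two independent gaps. Up to renaming of colours, nine relative positions of
   the palettes of u and v suffice, and for each of them a table provides the palette of w, for
   every distribution of the neighbours of w over the two new gaps. *)

theory Submission
  imports Defs
begin

section \<open>Plane topology of arcs with common ends\<close>

section \<open>Theta curves\<close>

text \<open>Each of the two insides is connected and misses the frontier of the other, so a common
  point makes them equal. Equal insides have equal frontiers, which puts \<open>c3\<close> on the
  other two arcs and leaves it nothing but its two ends.\<close>

lemma theta_common_inside:
  fixes c1 c2 c3 :: "real \<Rightarrow> complex"
  assumes c: "arc c1" "pathstart c1 = a" "pathfinish c1 = b"
    "arc c2" "pathstart c2 = a" "pathfinish c2 = b"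
    "arc c3" "pathstart c3 = a" "pathfinish c3 = b"
    and int: "path_image c1 \<inter> path_image c2 = {a, b}" "path_image c1 \<inter> path_image c3 = {a, b}"
      "path_image c2 \<inter> path_image c3 = {a, b}"
    and d1: "path_image c1 \<inter> inside (path_image c2 \<union> path_image c3) = {}"
    and d3: "path_image c3 \<inter> inside (path_image c1 \<union> path_image c2) = {}"
    and x: "x \<in> inside (path_image c2 \<union> path_image c3)" "x \<in> inside (path_image c1 \<union> path_image c2)"
  shows False
proof -
  let ?A = "inside (path_image c2 \<union> path_image c3)" and ?B = "inside (path_image c1 \<union> path_image c2)"
  have "simple_path (c2 +++ reversepath c3)" "simple_path (c1 +++ reversepath c2)"
    using c int by (auto simp: simple_path_join_loop_eq arc_reversepath)
  from this[THEN Jordan_inside_outside]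
  have J: "connected ?A" "frontier ?A = path_image c2 \<union> path_image c3"
    "connected ?B" "frontier ?B = path_image c1 \<union> path_image c2"
    using c by (simp_all add: path_image_join)
  have AB: "?A \<inter> ?B \<noteq> {}" "?B \<inter> ?A \<noteq> {}" using x by auto
  have "?A \<inter> frontier ?B = {}"
    unfolding J(4) using d1 inside_no_overlap[of "path_image c2 \<union> path_image c3"] by blast
  then have "?A \<subseteq> ?B" by (metis AB(1) Diff_eq_empty_iff J(1) connected_Int_frontier)
  moreover have "?B \<subseteq> ?A"
  proof (rule ccontr)
    assume "\<not> ?B \<subseteq> ?A"
    then have "?B - ?A \<noteq> {}" by (simp only: Diff_eq_empty_iff not_False_eq_True)
    from connected_Int_frontier[OF J(3) AB(2) this] have "?B \<inter> (path_image c2 \<union> path_image c3) \<noteq> {}"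
      by (simp only: J(2) not_False_eq_True)
    then show False using d3 inside_no_overlap[of "path_image c1 \<union> path_image c2"] by blast
  qed
  ultimately have "?A = ?B" by (rule subset_antisym)
  then have "frontier ?A = frontier ?B" by (rule arg_cong)
  then have "path_image c3 \<subseteq> path_image c1 \<union> path_image c2" unfolding J(2,4) by blast
  then have "path_image c3 \<subseteq> {a, b}" using int by blast
  moreover have "path_image c3 - {pathstart c3, pathfinish c3} \<noteq> {}"
    using c(7) by (intro nonempty_simple_path_endless arc_imp_simple_path)
  ultimately show False unfolding c by blast
qed

text \<open>If no arc met the inside of the closed curve formed by the other two, then, as two of the closed
  curves share exactly the connected set \<open>path_image c1\<close>, Janiszewski's theorem would join a point
  inside the third curve to infinity.\<close>

lemma theta_arc_inside:
  fixes c1 c2 c3 :: "real \<Rightarrow> complex"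
  assumes c: "arc c1" "pathstart c1 = a" "pathfinish c1 = b"
    "arc c2" "pathstart c2 = a" "pathfinish c2 = b"
    "arc c3" "pathstart c3 = a" "pathfinish c3 = b"
    and int: "path_image c1 \<inter> path_image c2 = {a, b}" "path_image c1 \<inter> path_image c3 = {a, b}"
      "path_image c2 \<inter> path_image c3 = {a, b}"
  shows "path_image c1 \<inter> inside (path_image c2 \<union> path_image c3) \<noteq> {} \<or>
         path_image c2 \<inter> inside (path_image c1 \<union> path_image c3) \<noteq> {} \<or>
         path_image c3 \<inter> inside (path_image c1 \<union> path_image c2) \<noteq> {}"
proof (rule ccontr)
  let ?P1 = "path_image c1" and ?P2 = "path_image c2" and ?P3 = "path_image c3"
  assume "\<not> ?thesis"
  then have d: "?P1 \<inter> inside (?P2 \<union> ?P3) = {}" "?P2 \<inter> inside (?P1 \<union> ?P3) = {}"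
    "?P3 \<inter> inside (?P1 \<union> ?P2) = {}" by auto
  have "simple_path (c2 +++ reversepath c3)" "simple_path (c1 +++ reversepath c2)" "simple_path (c1 +++ reversepath c3)"
    using c int by (auto simp: simple_path_join_loop_eq arc_reversepath)
  from this[THEN Jordan_inside_outside]
  have J: "inside (?P2 \<union> ?P3) \<noteq> {}"
    "connected (outside (?P1 \<union> ?P2))" "connected (outside (?P1 \<union> ?P3))"
    using c by (simp_all add: path_image_join)
  have comp: "compact ?P1" "compact ?P2" "compact ?P3"
    using c by (simp_all add: compact_arc_image)
  obtain x where x: "x \<in> inside (?P2 \<union> ?P3)" using J(1) by blast
  have nx: "x \<notin> ?P1" "x \<notin> ?P2" "x \<notin> ?P3"
    using d(1) x inside_no_overlap[of "?P2 \<union> ?P3"] by blast+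
  have x12: "x \<notin> inside (?P1 \<union> ?P2)"
    using theta_common_inside[OF c int d(1,3) x] by blast
  have x13: "x \<notin> inside (?P1 \<union> ?P3)"
  proof
    assume h: "x \<in> inside (?P1 \<union> ?P3)"
    show False
      by (rule theta_common_inside[OF c(1-3,7-9,4-6) int(2,1), of x])
        (use int(3) d x h in \<open>simp_all add: Int_commute Un_commute\<close>)
  qed
  have "bounded (?P1 \<union> ?P2 \<union> ?P3)" using comp by (simp add: compact_imp_bounded)
  then obtain y where y: "y \<in> outside (?P1 \<union> ?P2 \<union> ?P3)" using outside_bounded_nonempty by blast
  have yo: "y \<in> outside (?P1 \<union> ?P2)" "y \<in> outside (?P1 \<union> ?P3)" "y \<in> outside (?P2 \<union> ?P3)"
    using y outside_mono[of "?P1 \<union> ?P2" "?P1 \<union> ?P2 \<union> ?P3"] outside_mono[of "?P1 \<union> ?P3" "?P1 \<union> ?P2 \<union> ?P3"]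
      outside_mono[of "?P2 \<union> ?P3" "?P1 \<union> ?P2 \<union> ?P3"] by blast+
  have "x \<in> outside (?P1 \<union> ?P2)" "x \<in> outside (?P1 \<union> ?P3)"
    using nx x12 x13 inside_Un_outside[of "?P1 \<union> ?P2"] inside_Un_outside[of "?P1 \<union> ?P3"] by blast+
  then have cc: "connected_component (- (?P1 \<union> ?P2)) x y" "connected_component (- (?P1 \<union> ?P3)) x y"
    unfolding connected_component_def using J(2,3) yo outside_no_overlap by blast+
  have "(?P1 \<union> ?P2) \<inter> (?P1 \<union> ?P3) = ?P1" using int by blast
  then have "connected ((?P1 \<union> ?P2) \<inter> (?P1 \<union> ?P3))" using c by (simp add: connected_arc_image)
  note con = this
  have "compact (?P1 \<union> ?P2)" "closed (?P1 \<union> ?P3)"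
    using comp by (simp_all add: compact_Un compact_imp_closed closed_Un)
  then have "connected_component (- ((?P1 \<union> ?P2) \<union> (?P1 \<union> ?P3))) x y"
    by (rule Janiszewski[OF _ _ con cc])
  then have "connected_component (- (?P2 \<union> ?P3)) x y"
    by (rule connected_component_of_subset) blast
  then have "y \<in> inside (?P2 \<union> ?P3)" using x inside_same_component by blast
  then show False using yo(3) inside_Int_outside by blast
qed

text \<open>Without its ends the arc is still connected and avoids \<open>S\<close>, so it cannot
  pass from the open set \<open>inside S\<close> to the open set \<open>outside S\<close>.\<close>

lemma endless_arc_inside:
  fixes d :: "real \<Rightarrow> complex"
  assumes d: "arc d" and S: "closed S" "S \<inter> path_image d = {pathstart d, pathfinish d}"
    and ne: "path_image d \<inter> inside S \<noteq> {}"
  shows "path_image d - {pathstart d, pathfinish d} \<subseteq> inside S"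
proof -
  let ?D = "path_image d - {pathstart d, pathfinish d}"
  have "connected ?D" using d by (intro connected_simple_path_endless arc_imp_simple_path)
  moreover have "?D \<subseteq> inside S \<union> outside S" using S(2) inside_Un_outside[of S] by blast
  moreover have "open (inside S)" "open (outside S)" using S(1) by (auto intro: open_inside open_outside)
  moreover have "?D \<inter> inside S \<noteq> {}" using ne S(2) inside_no_overlap[of S] by blast
  ultimately have "?D \<inter> outside S = {}"
    using connectedD[of ?D "inside S" "outside S"] inside_Int_outside[of S] by blast
  then show ?thesis using \<open>?D \<subseteq> inside S \<union> outside S\<close> by blast
qed

lemma arc_ends_in_closure:
  fixes d :: "real \<Rightarrow> complex"
  assumes "arc d"
  shows "pathstart d \<in> closure (path_image d - {pathstart d, pathfinish d})"
    and "pathfinish d \<in> closure (path_image d - {pathstart d, pathfinish d})"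
proof -
  have cont: "continuous_on {0..1} d" and inj: "inj_on d {0..1}"
    using assms by (auto simp: arc_def path_def)
  have "d ` {0<..<1} \<subseteq> path_image d - {pathstart d, pathfinish d}"
    using assms by (simp add: simple_path_endless arc_imp_simple_path)
  moreover have "d ` closure {0<..<1} \<subseteq> closure (d ` {0<..<1})"
    using cont by (intro image_closure_subset closed_closure closure_subset) simp
  ultimately have *: "d ` {0..1} \<subseteq> closure (path_image d - {pathstart d, pathfinish d})"
    using closure_mono[of "d ` {0<..<1}" "path_image d - {pathstart d, pathfinish d}"] by simp
  show "pathstart d \<in> closure (path_image d - {pathstart d, pathfinish d})"
    and "pathfinish d \<in> closure (path_image d - {pathstart d, pathfinish d})"
    using * by (auto simp: pathstart_def pathfinish_def)
qed

text \<open>\<open>c3\<close> cuts the inside of the closed curve formed by \<open>c1\<close> and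
  \<open>c2\<close> into two regions. The inner part of \<open>d\<close> avoids \<open>c3\<close>
  and stays in one of them, but the closure of that region misses one end of \<open>d\<close>,
  namely the end on the arc that does not bound it.\<close>

lemma crossing_arcs_not_inside:
  fixes c1 c2 c3 d :: "real \<Rightarrow> complex"
  assumes c: "arc c1" "pathstart c1 = a" "pathfinish c1 = b"
    "arc c2" "pathstart c2 = a" "pathfinish c2 = b"
    "arc c3" "pathstart c3 = a" "pathfinish c3 = b"
    and int: "path_image c1 \<inter> path_image c2 = {a, b}" "path_image c1 \<inter> path_image c3 = {a, b}"
      "path_image c2 \<inter> path_image c3 = {a, b}"
    and d: "arc d" "pathstart d \<in> path_image c1 - {a, b}" "pathfinish d \<in> path_image c2 - {a, b}"
    and dint: "(path_image c1 \<union> path_image c2) \<inter> path_image d = {pathstart d, pathfinish d}"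
      "path_image c3 \<inter> path_image d = {}"
    and i3: "path_image c3 \<inter> inside (path_image c1 \<union> path_image c2) \<noteq> {}"
    and id: "path_image d \<inter> inside (path_image c1 \<union> path_image c2) \<noteq> {}"
  shows False
proof -
  let ?P1 = "path_image c1" and ?P2 = "path_image c2" and ?P3 = "path_image c3"
  let ?D = "path_image d - {pathstart d, pathfinish d}"
  have ab: "a \<noteq> b" using c arc_distinct_ends by metis
  have cl: "closed ?P1" "closed ?P2" "closed ?P3" using c by (simp_all add: closed_arc_image)
  have split: "inside (?P1 \<union> ?P3) \<inter> inside (?P2 \<union> ?P3) = {}"
    "inside (?P1 \<union> ?P3) \<union> inside (?P2 \<union> ?P3) \<union> (?P3 - {a, b}) = inside (?P1 \<union> ?P2)"
    using split_inside_simple_closed_curve[OF _ c(2,3) _ c(5,6) _ c(8,9) ab int i3]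
      c(1,4,7) arc_imp_simple_path by blast+
  have D: "?D \<subseteq> inside (?P1 \<union> ?P2)"
    using d(1) cl dint(1) id by (intro endless_arc_inside) auto
  then have D': "?D \<subseteq> inside (?P1 \<union> ?P3) \<union> inside (?P2 \<union> ?P3)"
    using split(2) dint(2) by blast
  have op: "open (inside (?P1 \<union> ?P3))" "open (inside (?P2 \<union> ?P3))"
    using cl by (auto intro: open_inside)
  have conn: "connected ?D" using d by (intro connected_simple_path_endless arc_imp_simple_path)
  have "?D \<inter> inside (?P1 \<union> ?P3) = {} \<or> ?D \<inter> inside (?P2 \<union> ?P3) = {}"
    using connectedD[OF conn op _ D'] split(1) by blast
  then show False
  proof
    assume "?D \<inter> inside (?P1 \<union> ?P3) = {}"
    then have "?D \<subseteq> inside (?P2 \<union> ?P3)" using D' by blast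
    then have "pathstart d \<in> (?P2 \<union> ?P3) \<union> inside (?P2 \<union> ?P3)"
      using arc_ends_in_closure(1)[OF d(1)] closure_mono closure_inside_subset[of "?P2 \<union> ?P3"] cl by blast
    moreover have "pathstart d \<notin> inside (?P1 \<union> ?P2)"
      using d(2) inside_no_overlap[of "?P1 \<union> ?P2"] by blast
    ultimately show False using d(2) int split(2) by blast
  next
    assume "?D \<inter> inside (?P2 \<union> ?P3) = {}"
    then have "?D \<subseteq> inside (?P1 \<union> ?P3)" using D' by blast
    then have "pathfinish d \<in> (?P1 \<union> ?P3) \<union> inside (?P1 \<union> ?P3)"
      using arc_ends_in_closure(2)[OF d(1)] closure_mono closure_inside_subset[of "?P1 \<union> ?P3"] cl by blast
    moreover have "pathfinish d \<notin> inside (?P1 \<union> ?P2)"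
      using d(3) inside_no_overlap[of "?P1 \<union> ?P2"] by blast
    ultimately show False using d(3) int split(2) by blast
  qed
qed

section \<open>Paths, longest cycles and their ears\<close>

section \<open>Hamiltonian cycles\<close>

fun walk_edges :: "'a list \<Rightarrow> 'a set set" where
  "walk_edges (x # y # zs) = insert {x, y} (walk_edges (y # zs))"
| "walk_edges _ = {}"

lemma walk_edges_append:
  "walk_edges (xs @ y # ys) = walk_edges xs \<union> (if xs = [] then {} else {{last xs, y}}) \<union> walk_edges (y # ys)"
  by (induction xs rule: walk_edges.induct) auto

lemma walk_edges_rev: "walk_edges (rev xs) = walk_edges xs"
proof (induction xs rule: walk_edges.induct)
  case (1 x y zs)
  have "walk_edges (rev (x # y # zs)) = walk_edges (rev (y # zs) @ [x])" by simp
  also have "\<dots> = walk_edges (rev (y # zs)) \<union> {{y, x}}" by (subst walk_edges_append) simp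
  finally show ?case using 1 by (auto simp: insert_commute)
qed auto

lemma walk_edges_subset: "e \<in> walk_edges xs \<Longrightarrow> e \<subseteq> set xs"
  by (induction xs rule: walk_edges.induct) auto

lemma walk_edges_nth: "Suc i < length xs \<Longrightarrow> {xs ! i, xs ! Suc i} \<in> walk_edges xs"
  by (induction xs arbitrary: i rule: walk_edges.induct) (auto simp: nth_Cons split: nat.split)

text \<open>Only the inner vertices are listed, so that \<open>ys = []\<close> is a single edge and
  two paths are internally disjoint iff their lists are.\<close>

definition path_in :: "'a set set \<Rightarrow> 'a \<Rightarrow> 'a list \<Rightarrow> 'a \<Rightarrow> bool" where
  "path_in E a ys b \<longleftrightarrow> distinct (a # ys @ [b]) \<and> walk_edges (a # ys @ [b]) \<subseteq> E"

lemma ends_not_edge: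
  assumes "distinct (a # ys @ [b])" "ys \<noteq> []"
  shows "{a, b} \<notin> walk_edges (a # ys @ [b])"
proof -
  obtain z zs where ys: "ys = z # zs" using assms by (cases ys) auto
  have "a \<notin> e" if "e \<in> walk_edges (z # zs @ [b])" for e
    using walk_edges_subset[OF that] assms by (auto simp: ys)
  then show ?thesis using assms by (auto simp: ys doubleton_eq_iff)
qed

definition cycle_in :: "'a set set \<Rightarrow> 'a list \<Rightarrow> bool" where
  "cycle_in E xs \<longleftrightarrow> distinct xs \<and> length xs \<ge> 2 \<and> walk_edges xs \<subseteq> E \<and> {last xs, hd xs} \<in> E"

lemma cycle_in_rotate:
  assumes "cycle_in E (xs @ a # ys)"
  shows "cycle_in E (a # ys @ xs)"
proof (cases xs)
  case Nil
  then show ?thesis using assms by simp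
next
  case (Cons x xs')
  have "walk_edges (a # ys @ xs) = walk_edges (a # ys) \<union> {{last (a # ys), x}} \<union> walk_edges xs"
    using walk_edges_append[of "a # ys" x xs'] Cons by simp
  moreover have "walk_edges (xs @ a # ys) = walk_edges xs \<union> {{last xs, a}} \<union> walk_edges (a # ys)"
    using walk_edges_append[of xs a ys] Cons by simp
  ultimately show ?thesis
    using assms Cons unfolding cycle_in_def by (auto split: if_splits)
qed

text \<open>Turns a walk from \<open>x\<close> into \<open>B\<close> into a path that meets
  \<open>B\<close> only at its last vertex. With \<open>B\<close> the vertices of a cycle and
  \<open>S\<close> the graph minus one of them, this yields the ear.\<close>

lemma ear_path:
  assumes "(\<lambda>x y. x \<in> S \<and> y \<in> S \<and> {x, y} \<in> E)\<^sup>*\<^sup>* x y" "x \<notin> B" "y \<in> B" "x \<in> S"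
  shows "\<exists>ws b. b \<in> B \<and> b \<in> S \<and> distinct (x # ws @ [b]) \<and> set ws \<inter> B = {} \<and> set ws \<subseteq> S \<and>
           walk_edges (x # ws @ [b]) \<subseteq> E"
  using assms
proof (induction rule: converse_rtranclp_induct)
  case base
  then show ?case by blast
next
  case (step x z)
  show ?case
  proof (cases "z \<in> B")
    case True
    have "x \<noteq> z" using True step.prems(1) by blast
    then have "distinct (x # [] @ [z])" "walk_edges (x # [] @ [z]) \<subseteq> E" using step.hyps(1) by auto
    then show ?thesis using True step.hyps(1) by (metis empty_set empty_subsetI inf_bot_left)
  next
    case False
    then obtain ws b where w: "b \<in> B" "b \<in> S" "distinct (z # ws @ [b])" "set ws \<inter> B = {}" "set ws \<subseteq> S"
      "walk_edges (z # ws @ [b]) \<subseteq> E" using step by blast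
    show ?thesis
    proof (cases "x \<in> set (z # ws)")
      case True
      \<comment> \<open>The new first vertex already lies on the path, which is cut to begin
        there.\<close>
      then obtain us vs where uv: "z # ws = us @ x # vs" by (meson split_list)
      then have eq: "z # ws @ [b] = us @ x # (vs @ [b])" by (metis append_Cons append_assoc)
      have "walk_edges (x # vs @ [b]) \<subseteq> E" "distinct (x # vs @ [b])"
        using w(6)[unfolded eq walk_edges_append] w(3)[unfolded eq] by simp_all
      moreover have "set vs \<subseteq> set ws" using uv by (cases us) auto
      ultimately show ?thesis using w by (intro exI[of _ vs] exI[of _ b]) blast
    next
      case False
      then have "distinct (x # (z # ws) @ [b])" using w(1,3) step.prems(1) by auto
      moreover have "walk_edges (x # (z # ws) @ [b]) \<subseteq> E" using w(6) step.hyps(1) by simp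
      moreover have "set (z # ws) \<inter> B = {}" "set (z # ws) \<subseteq> S"
        using w(4,5) \<open>z \<notin> B\<close> step.hyps(1) by auto
      ultimately show ?thesis using w(1,2) by blast
    qed
  qed
qed

text \<open>A longest cycle is Hamiltonian: an ear of it would either lengthen it or form a theta graph
  all of whose three paths have inner vertices. An edge counts as a cycle of length two, so that no
  separate argument is needed for the existence of cycles.\<close>

lemma hamiltonian_cycle_exists:
  fixes V :: "'a set"
  assumes G: "simple_graph V E" "two_connected V E"
    and no_theta: "\<And>a b xs ys zs. path_in E a xs b \<Longrightarrow> path_in E a ys b \<Longrightarrow> path_in E a zs b \<Longrightarrow>
      set xs \<inter> set ys = {} \<Longrightarrow> set xs \<inter> set zs = {} \<Longrightarrow> set ys \<inter> set zs = {} \<Longrightarrow>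
      xs \<noteq> [] \<Longrightarrow> ys \<noteq> [] \<Longrightarrow> zs = []"
  shows "\<exists>xs. cycle_in E xs \<and> set xs = V"
proof -
  have fin: "finite V" and EV: "\<And>e. e \<in> E \<Longrightarrow> e \<subseteq> V \<and> card e = 2" using G(1) by (auto simp: simple_graph_def)
  have sub: "set xs \<subseteq> V" if "cycle_in E xs" for xs
  proof
    fix v assume "v \<in> set xs"
    then obtain ys zs where "xs = ys @ v # zs" by (meson split_list)
    then have c: "cycle_in E (v # zs @ ys)" using that cycle_in_rotate[of E ys v zs] by simp
    then have "{last (v # zs @ ys), v} \<in> E" by (simp add: cycle_in_def)
    then show "v \<in> V" using EV by blast
  qed
  have len: "length xs \<le> card V" if "cycle_in E xs" for xs
    using sub[OF that] that fin card_mono[of V "set xs"] by (auto simp: cycle_in_def distinct_card)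
  have card: "card V \<ge> 3" and con: "connected_on E V" and con': "\<And>v. v \<in> V \<Longrightarrow> connected_on E (V - {v})"
    using G(2) by (auto simp: two_connected_def)
  \<comment> \<open>By connectedness some walk leads from \<open>S\<close> to its complement, and
    one of its edges leaves \<open>S\<close>.\<close>
  have leave: "\<exists>a x. a \<in> S \<and> x \<in> V \<and> x \<notin> S \<and> {a, x} \<in> E" if S: "S \<subseteq> V" "S \<noteq> {}" "S \<noteq> V" for S
  proof -
    obtain a y where a: "a \<in> S" "a \<in> V" and y: "y \<in> V" "y \<notin> S" using S by blast
    have "(\<lambda>x y. x \<in> V \<and> y \<in> V \<and> {x, y} \<in> E)\<^sup>*\<^sup>* a y" using con a y by (simp add: connected_on_def)
    then show ?thesis using a(1) y(2)
    proof (induction rule: converse_rtranclp_induct)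
      case (step u w)
      then show ?case by (cases "w \<in> S") blast+
    qed blast
  qed
  obtain v0 where v0: "v0 \<in> V" using card by (cases "V = {}") auto
  have "{v0} \<noteq> V"
  proof
    assume "{v0} = V"
    then have "card V = card {v0}" by simp
    then show False using card by simp
  qed
  then obtain v1 where "{v0, v1} \<in> E" "v1 \<noteq> v0" using leave[of "{v0}"] v0 by auto
  then have "cycle_in E [v0, v1]" by (simp add: cycle_in_def insert_commute)
  \<comment> \<open>Cycle lengths are bounded by \<open>card V\<close>, so there is a longest
    cycle.\<close>
  then obtain xs where xs: "cycle_in E xs" and maxl: "\<And>ys. cycle_in E ys \<Longrightarrow> length ys \<le> length xs"
    using ex_has_greatest_nat[of "cycle_in E" "[v0, v1]" length "Suc (card V)"] len by (auto simp: less_Suc_eq_le)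
  have "set xs = V"
  proof (rule ccontr)
    assume ne: "set xs \<noteq> V"
    have "set xs \<noteq> {}" using xs by (auto simp: cycle_in_def)
    then obtain a x where ax: "a \<in> set xs" "x \<in> V" "x \<notin> set xs" "{a, x} \<in> E"
      using leave[OF sub[OF xs] _ ne] by blast
    obtain us vs where "xs = us @ a # vs" using ax(1) by (meson split_list)
    then have cyc: "cycle_in E (a # vs @ us)" using xs cycle_in_rotate[of E us a vs] by simp
    have len_eq: "length (a # vs @ us) = length xs" and set_eq: "set (a # vs @ us) = set xs"
      using \<open>xs = us @ a # vs\<close> by auto
    have aV: "a \<in> V" using ax sub[OF xs] by blast
    obtain y where y: "y \<in> set xs" "y \<noteq> a"
      using cyc set_eq by (cases "vs @ us") (auto simp: cycle_in_def)
    \<comment> \<open>As \<open>V - {a}\<close> is connected, the ear from \<open>x\<close> can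
      avoid \<open>a\<close>, and its end \<open>b\<close> on the cycle differs from
      \<open>a\<close>.\<close>
    have "(\<lambda>x y. x \<in> V - {a} \<and> y \<in> V - {a} \<and> {x, y} \<in> E)\<^sup>*\<^sup>* x y"
      using con'[OF aV] ax y sub[OF xs] unfolding connected_on_def by blast
    from ear_path[OF this ax(3) y(1)] ax obtain ws b where w: "b \<in> set xs" "b \<in> V - {a}"
      "distinct (x # ws @ [b])" "set ws \<inter> set xs = {}" "set ws \<subseteq> V - {a}" "walk_edges (x # ws @ [b]) \<subseteq> E"
      by blast
    have "b \<in> set (vs @ us)" using w(1,2) set_eq by auto
    then obtain ys ts where yt: "vs @ us = ys @ b # ts" by (meson split_list)
    have c: "cycle_in E (a # ys @ b # ts)" using cyc yt by simp
    have len2: "length (a # ys @ b # ts) = length xs" and set2: "set (a # ys @ b # ts) = set xs"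
      using len_eq set_eq yt by auto
    have dist: "distinct (a # ys @ b # ts)" using c by (simp add: cycle_in_def)
    have disj: "set (x # ws) \<inter> set (a # ys @ b # ts) = {}" using w(4) ax(3) set2 by auto
    have we: "walk_edges (a # ys @ b # ts) \<subseteq> E" "{last (b # ts), a} \<in> E"
      using c by (auto simp: cycle_in_def)
    have we1: "walk_edges (a # ys @ [b]) \<subseteq> E" "walk_edges (b # ts) \<subseteq> E"
      using we(1) walk_edges_append[of "a # ys" b ts] walk_edges_append[of "a # ys" b "[]"] by auto
    have p1: "path_in E a ys b" using dist we1 by (auto simp: path_in_def)
    have p2: "path_in E a (x # ws) b" using disj dist w(3,6) ax(4) by (auto simp: path_in_def)
    \<comment> \<open>The other side of the cycle is read backwards, so that all three paths run
      from \<open>a\<close> to \<open>b\<close>.\<close>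
    have p3: "path_in E a (rev ts) b"
    proof -
      have "walk_edges (b # ts @ [a]) \<subseteq> E"
        using we we1 walk_edges_append[of "b # ts" a "[]"] by (auto split: if_splits)
      then have "walk_edges (rev (b # ts @ [a])) \<subseteq> E" by (simp only: walk_edges_rev)
      then show ?thesis using dist by (simp add: path_in_def)
    qed
    \<comment> \<open>If \<open>a\<close> and \<open>b\<close> were joined by an edge of the cycle,
      the ear could replace this edge and give a longer cycle. The same is used for the other side
      below.\<close>
    have "ys \<noteq> []"
    proof
      assume "ys = []"
      have "walk_edges ((a # x # ws) @ b # ts) \<subseteq> E"
        using walk_edges_append[of "a # x # ws" b ts] walk_edges_append[of "a # x # ws" b "[]"] p2 we1
        by (auto simp: path_in_def)
      moreover have "distinct ((a # x # ws) @ b # ts)" using disj dist w(3) by auto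
      ultimately have "cycle_in E ((a # x # ws) @ b # ts)" using we(2) by (simp add: cycle_in_def)
      from maxl[OF this] show False using len2 \<open>ys = []\<close> by simp
    qed
    moreover have "rev ts \<noteq> []"
    proof
      assume "rev ts = []"
      have "walk_edges ((a # ys) @ b # rev (x # ws)) \<subseteq> E"
      proof -
        have "walk_edges (b # rev (x # ws)) = walk_edges (x # ws @ [b])"
          using walk_edges_rev[of "x # ws @ [b]"] by simp
        then show ?thesis
          using walk_edges_append[of "a # ys" b "rev (x # ws)"] walk_edges_append[of "a # ys" b "[]"] we1 w(6) by auto
      qed
      moreover have "distinct ((a # ys) @ b # rev (x # ws))" using disj dist w(3) by auto
      moreover have "{last ((a # ys) @ b # rev (x # ws)), a} \<in> E" using ax(4) by (simp add: insert_commute)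
      ultimately have "cycle_in E ((a # ys) @ b # rev (x # ws))" by (simp add: cycle_in_def)
      from maxl[OF this] show False using len2 \<open>rev ts = []\<close> by simp
    qed
    moreover have "set ys \<inter> set (rev ts) = {}" "set ys \<inter> set (x # ws) = {}" "set (rev ts) \<inter> set (x # ws) = {}"
      using dist disj by auto
    ultimately show False using no_theta[OF p1 p3 p2] by blast
  qed
  then show ?thesis using xs by blast
qed

section \<open>From a drawing to a Hamiltonian cycle without crossing chords\<close>

section \<open>Outerplanar drawings\<close>

lemma Union_walk_edges: "length xs \<ge> 2 \<Longrightarrow> \<Union> (walk_edges xs) = set xs"
proof (induction xs rule: walk_edges.induct)
  case (1 x y zs)
  then show ?case by (cases zs) auto
qed auto

lemma walk_edges_split: "walk_edges (a # xs @ b # ys) = walk_edges (a # xs @ [b]) \<union> walk_edges (b # ys)"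
  using walk_edges_append[of "a # xs" b ys] walk_edges_append[of "a # xs" b "[]"] by simp

lemma drop_split: "m \<le> j \<Longrightarrow> j < length xs \<Longrightarrow> \<exists>ys. drop m xs = ys @ xs ! j # drop (Suc j) xs"
  using id_take_nth_drop[of "j - m" "drop m xs"] by (intro exI[of _ "take (j - m) (drop m xs)"]) simp

locale drawing =
  fixes V :: "'a set" and E :: "'a set set" and p :: "'a \<Rightarrow> complex" and \<gamma> :: "'a set \<Rightarrow> real \<Rightarrow> complex"
  assumes drawn: "outerplanar_drawing V E p \<gamma>" and graph: "simple_graph V E"
begin

lemma edge_card: "e \<in> E \<Longrightarrow> card e = 2" and edge_subset: "e \<in> E \<Longrightarrow> e \<subseteq> V"
  using graph by (auto simp: simple_graph_def)

lemma p_eq_iff: "x \<in> V \<Longrightarrow> y \<in> V \<Longrightarrow> p x = p y \<longleftrightarrow> x = y"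
  using drawn by (auto simp: outerplanar_drawing_def inj_on_def)

lemma curve_vertices: "e \<in> E \<Longrightarrow> path_image (\<gamma> e) \<inter> p ` V = p ` e"
  using drawn by (auto simp: outerplanar_drawing_def)

lemma curves_meet: "e \<in> E \<Longrightarrow> f \<in> E \<Longrightarrow> e \<noteq> f \<Longrightarrow> path_image (\<gamma> e) \<inter> path_image (\<gamma> f) \<subseteq> p ` (e \<inter> f)"
  using drawn by (simp add: outerplanar_drawing_def)

lemma edge_curve:
  "e \<in> E \<Longrightarrow> arc (\<gamma> e) \<and> (\<exists>u v. e = {u, v} \<and> pathstart (\<gamma> e) = p u \<and> pathfinish (\<gamma> e) = p v)"
  using drawn by (simp add: outerplanar_drawing_def)

lemma vertex_on_curve: "e \<in> E \<Longrightarrow> v \<in> e \<Longrightarrow> p v \<in> path_image (\<gamma> e)"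
  using curve_vertices by blast

definition trail :: "'a list \<Rightarrow> complex set" where
  "trail xs = (\<Union>e\<in>walk_edges xs. path_image (\<gamma> e))"

lemma trail_Int:
  assumes "walk_edges xs \<subseteq> E" "walk_edges ys \<subseteq> E" "walk_edges xs \<inter> walk_edges ys = {}"
  shows "trail xs \<inter> trail ys = p ` (\<Union> (walk_edges xs) \<inter> \<Union> (walk_edges ys))"
proof
  show "trail xs \<inter> trail ys \<subseteq> p ` (\<Union> (walk_edges xs) \<inter> \<Union> (walk_edges ys))"
  proof
    fix t assume "t \<in> trail xs \<inter> trail ys"
    then obtain e f where ef: "e \<in> walk_edges xs" "f \<in> walk_edges ys" "t \<in> path_image (\<gamma> e) \<inter> path_image (\<gamma> f)"
      by (auto simp: trail_def)
    then have "e \<in> E" "f \<in> E" "e \<noteq> f" using assms by auto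
    then have "t \<in> p ` (e \<inter> f)" using curves_meet ef(3) by blast
    then show "t \<in> p ` (\<Union> (walk_edges xs) \<inter> \<Union> (walk_edges ys))" using ef by blast
  qed
  show "p ` (\<Union> (walk_edges xs) \<inter> \<Union> (walk_edges ys)) \<subseteq> trail xs \<inter> trail ys"
  proof
    fix t assume "t \<in> p ` (\<Union> (walk_edges xs) \<inter> \<Union> (walk_edges ys))"
    then obtain v e f where v: "t = p v" "v \<in> e" "e \<in> walk_edges xs" "v \<in> f" "f \<in> walk_edges ys" by auto
    moreover have "e \<in> E" "f \<in> E" using v(3,5) assms(1,2) by auto
    ultimately have "p v \<in> path_image (\<gamma> e)" "p v \<in> path_image (\<gamma> f)" by (simp_all add: vertex_on_curve)
    then show "t \<in> trail xs \<inter> trail ys" using v(1,3,5) unfolding trail_def by blast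
  qed
qed

lemma edge_arc:
  assumes "{x, y} \<in> E"
  obtains g where "arc g" "pathstart g = p x" "pathfinish g = p y" "path_image g = path_image (\<gamma> {x, y})"
proof -
  obtain u v where uv: "{x, y} = {u, v}" "pathstart (\<gamma> {x, y}) = p u" "pathfinish (\<gamma> {x, y}) = p v"
    and arc: "arc (\<gamma> {x, y})"
    using edge_curve[OF assms] by blast
  show thesis
  proof (cases "u = x")
    case True
    then have "v = y" using uv(1) by (auto simp: doubleton_eq_iff)
    then show thesis using that[of "\<gamma> {x, y}"] arc uv(2,3) True by simp
  next
    case False
    then have "u = y" "v = x" using uv(1) by (auto simp: doubleton_eq_iff)
    then show thesis using that[of "reversepath (\<gamma> {x, y})"] arc uv(2,3) by (simp add: arc_reversepath)
  qed
qed

text \<open>The edge curves are joined one by one. The first vertex lies on no later edge, so the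
  first curve meets the rest only where it is joined to it.\<close>

lemma path_arc:
  assumes "path_in E a xs b"
  shows "\<exists>g. arc g \<and> pathstart g = p a \<and> pathfinish g = p b \<and> path_image g = trail (a # xs @ [b])"
  using assms
proof (induction xs arbitrary: a)
  case Nil
  then show ?case using edge_arc[of a b] by (auto simp: path_in_def trail_def)
next
  case (Cons x xs)
  then have E: "{a, x} \<in> E" and rest: "path_in E x xs b" and d: "distinct (a # x # xs @ [b])"
    by (auto simp: path_in_def)
  obtain g where g: "arc g" "pathstart g = p a" "pathfinish g = p x" "path_image g = path_image (\<gamma> {a, x})"
    using edge_arc[OF E] .
  obtain h where h: "arc h" "pathstart h = p x" "pathfinish h = p b" "path_image h = trail (x # xs @ [b])"
    using Cons.IH[OF rest] by blast
  have "path_image g \<inter> path_image h \<subseteq> {p x}"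
  proof
    fix t assume "t \<in> path_image g \<inter> path_image h"
    then obtain f where f: "f \<in> walk_edges (x # xs @ [b])" "t \<in> path_image (\<gamma> {a, x}) \<inter> path_image (\<gamma> f)"
      by (auto simp: g(4) h(4) trail_def)
    have "a \<notin> f" using walk_edges_subset[OF f(1)] d by auto
    then have "{a, x} \<noteq> f" by blast
    moreover have "f \<in> E" using f(1) rest by (auto simp: path_in_def)
    ultimately have "t \<in> p ` ({a, x} \<inter> f)" using curves_meet[OF E] f(2) by blast
    then show "t \<in> {p x}" using \<open>a \<notin> f\<close> by blast
  qed
  then have "arc (g +++ h)" using g h by (intro arc_join) auto
  moreover have "path_image (g +++ h) = trail (a # (x # xs) @ [b])"
    using g h by (simp add: path_image_join trail_def)
  ultimately show ?case using g h by (intro exI[of _ "g +++ h"]) simp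
qed

lemma trail_closed:
  assumes "path_in E a xs b"
  shows "closed (trail (a # xs @ [b]))"
  using path_arc[OF assms] closed_arc_image by metis

lemma trail_subset: "path_in E a xs b \<Longrightarrow> trail (a # xs @ [b]) \<subseteq> p ` V \<union> (\<Union>e\<in>E. path_image (\<gamma> e))"
  unfolding trail_def path_in_def by blast

lemma path_vertex_edge:
  assumes "path_in E a xs b" "v \<in> set (a # xs @ [b])"
  obtains e where "e \<in> walk_edges (a # xs @ [b])" "e \<in> E" "v \<in> e"
proof -
  have "v \<in> \<Union> (walk_edges (a # xs @ [b]))"
    using Union_walk_edges[of "a # xs @ [b]"] assms(2) by simp
  then show thesis using that assms(1) unfolding path_in_def by blast
qed

lemma trail_inner: "path_in E a xs b \<Longrightarrow> v \<in> set (a # xs @ [b]) \<Longrightarrow> p v \<in> trail (a # xs @ [b])"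
  unfolding trail_def using vertex_on_curve by (meson UN_I path_vertex_edge)

lemma path_vertices: "path_in E a xs b \<Longrightarrow> set (a # xs @ [b]) \<subseteq> V"
  using edge_subset by (meson path_vertex_edge subset_iff)

text \<open>Outerplanarity enters here: \<open>p v\<close> is a limit of points outside the whole
  drawing, hence outside \<open>S\<close>, and an open neighbourhood such as \<open>inside S\<close>
  would contain some of them.\<close>

lemma vertex_not_inside:
  assumes "closed S" "S \<subseteq> p ` V \<union> (\<Union>e\<in>E. path_image (\<gamma> e))" "v \<in> V"
  shows "p v \<notin> inside S"
proof
  assume "p v \<in> inside S"
  moreover have "p v \<in> closure (outside (p ` V \<union> (\<Union>e\<in>E. path_image (\<gamma> e))))"
    using drawn assms(3) by (simp add: outerplanar_drawing_def)
  then have "p v \<in> closure (outside S)" using outside_mono[OF assms(2)] closure_mono by blast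
  moreover have "open (inside S)" using assms(1) by (rule open_inside)
  ultimately have "inside S \<inter> outside S \<noteq> {}" using open_Int_closure_eq_empty by blast
  then show False by (simp add: inside_Int_outside)
qed

text \<open>An edge common to both paths would have to be \<open>{a, b}\<close>, which a path with
  inner vertices does not use. So the paths share no edge, and their curves meet at common vertices
  only.\<close>

lemma paths_meet:
  assumes "path_in E a xs b" "path_in E a ys b" "set xs \<inter> set ys = {}" "xs \<noteq> []"
  shows "trail (a # xs @ [b]) \<inter> trail (a # ys @ [b]) = {p a, p b}"
proof -
  have d: "distinct (a # xs @ [b])" "distinct (a # ys @ [b])"
    and e: "walk_edges (a # xs @ [b]) \<subseteq> E" "walk_edges (a # ys @ [b]) \<subseteq> E"
    using assms by (auto simp: path_in_def)
  have common: "set (a # xs @ [b]) \<inter> set (a # ys @ [b]) = {a, b}" using d assms(3) by auto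
  have "walk_edges (a # xs @ [b]) \<inter> walk_edges (a # ys @ [b]) = {}"
  proof (rule ccontr)
    assume "walk_edges (a # xs @ [b]) \<inter> walk_edges (a # ys @ [b]) \<noteq> {}"
    then obtain f where f: "f \<in> walk_edges (a # xs @ [b])" "f \<in> walk_edges (a # ys @ [b])" by blast
    then have "f \<subseteq> {a, b}" using walk_edges_subset[of f] common by blast
    moreover have "card f = 2" using f(1) e(1) edge_card by blast
    ultimately have "f = {a, b}" using d(1) by (intro card_subset_eq) auto
    then show False using f(1) ends_not_edge[OF d(1) assms(4)] by simp
  qed
  from trail_Int[OF e this] show ?thesis
    using Union_walk_edges[of "a # xs @ [b]"] Union_walk_edges[of "a # ys @ [b]"] assms(3) by simp
qed

text \<open>One of the three paths runs inside the closed curve of the other two. No vertex can lie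
  there, so that path is a single edge and must be the third one. The conclusion
  \<open>zs = []\<close> excludes the theta graphs for the Hamiltonian cycle; the other one places
  chords inside the cycle.\<close>

lemma theta_path_inside:
  assumes xs: "path_in E a xs b" "xs \<noteq> []" and ys: "path_in E a ys b" "ys \<noteq> []" and zs: "path_in E a zs b"
    and disj: "set xs \<inter> set ys = {}" "set xs \<inter> set zs = {}" "set ys \<inter> set zs = {}"
  shows "trail (a # zs @ [b]) \<inter> inside (trail (a # xs @ [b]) \<union> trail (a # ys @ [b])) \<noteq> {}" and "zs = []"
proof -
  have meet: "trail (a # xs @ [b]) \<inter> trail (a # ys @ [b]) = {p a, p b}"
    "trail (a # xs @ [b]) \<inter> trail (a # zs @ [b]) = {p a, p b}"
    "trail (a # ys @ [b]) \<inter> trail (a # zs @ [b]) = {p a, p b}"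
    using paths_meet assms by blast+
  have no_inner: "ws = []"
    if w: "path_in E a ws b" "path_in E a us b" "path_in E a vs b"
      and m: "trail (a # ws @ [b]) \<inter> trail (a # us @ [b]) = {p a, p b}"
        "trail (a # ws @ [b]) \<inter> trail (a # vs @ [b]) = {p a, p b}"
      and i: "trail (a # ws @ [b]) \<inter> inside (trail (a # us @ [b]) \<union> trail (a # vs @ [b])) \<noteq> {}"
    for ws us vs
  proof (rule ccontr)
    assume "ws \<noteq> []"
    then obtain v where v: "v \<in> set ws" by (cases ws) auto
    obtain g where g: "arc g" "pathstart g = p a" "pathfinish g = p b" "path_image g = trail (a # ws @ [b])"
      using path_arc[OF w(1)] by blast
    have cl: "closed (trail (a # us @ [b]) \<union> trail (a # vs @ [b]))" using trail_closed w(2,3) by (intro closed_Un)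
    have "trail (a # ws @ [b]) - {p a, p b} \<subseteq> inside (trail (a # us @ [b]) \<union> trail (a # vs @ [b]))"
      using endless_arc_inside[OF g(1) cl] m i unfolding g by blast
    moreover have "v \<in> V" "p v \<noteq> p a" "p v \<noteq> p b"
      using path_vertices[OF w(1)] v w(1) p_eq_iff by (auto simp: path_in_def)
    moreover have "p v \<in> trail (a # ws @ [b])" using trail_inner[OF w(1)] v by simp
    ultimately have "p v \<in> inside (trail (a # us @ [b]) \<union> trail (a # vs @ [b]))" by blast
    then show False using vertex_not_inside[OF cl] trail_subset w(2,3) \<open>v \<in> V\<close> by blast
  qed
  obtain g1 where g1: "arc g1" "pathstart g1 = p a" "pathfinish g1 = p b" "path_image g1 = trail (a # xs @ [b])"
    using path_arc[OF xs(1)] by blast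
  obtain g2 where g2: "arc g2" "pathstart g2 = p a" "pathfinish g2 = p b" "path_image g2 = trail (a # ys @ [b])"
    using path_arc[OF ys(1)] by blast
  obtain g3 where g3: "arc g3" "pathstart g3 = p a" "pathfinish g3 = p b" "path_image g3 = trail (a # zs @ [b])"
    using path_arc[OF zs] by blast
  have "trail (a # xs @ [b]) \<inter> inside (trail (a # ys @ [b]) \<union> trail (a # zs @ [b])) \<noteq> {} \<or>
        trail (a # ys @ [b]) \<inter> inside (trail (a # xs @ [b]) \<union> trail (a # zs @ [b])) \<noteq> {} \<or>
        trail (a # zs @ [b]) \<inter> inside (trail (a # xs @ [b]) \<union> trail (a # ys @ [b])) \<noteq> {}"
    using theta_arc_inside[OF g1(1-3) g2(1-3) g3(1-3)] meet unfolding g1(4) g2(4) g3(4) by blast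
  moreover have "trail (a # xs @ [b]) \<inter> inside (trail (a # ys @ [b]) \<union> trail (a # zs @ [b])) = {}"
    using no_inner[OF xs(1) ys(1) zs meet(1,2)] xs(2) by blast
  moreover have "trail (a # ys @ [b]) \<inter> inside (trail (a # xs @ [b]) \<union> trail (a # zs @ [b])) = {}"
    using no_inner[OF ys(1) xs(1) zs _ meet(3)] meet(1) ys(2) by (simp only: Int_commute) blast
  ultimately show i: "trail (a # zs @ [b]) \<inter> inside (trail (a # xs @ [b]) \<union> trail (a # ys @ [b])) \<noteq> {}" by blast
  show "zs = []" using no_inner[OF zs xs(1) ys(1) _ _ i] meet(2,3) by (simp only: Int_commute)
qed

lemma path_in_rev: "path_in E a xs b \<Longrightarrow> path_in E b (rev xs) a"
  using walk_edges_rev[of "a # xs @ [b]"] by (auto simp: path_in_def)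

text \<open>Both chords lie inside the closed curve drawn by the cycle and their ends alternate on
  it. So their curves would have to meet, although the chords share no vertex.\<close>

lemma cycle_chords_not_crossing:
  assumes c: "cycle_in E (a # B @ b # C @ c # D @ d # F)" and ac: "{a, c} \<in> E" and bd: "{b, d} \<in> E"
  shows False
proof -
  let ?w1 = "walk_edges (a # B @ [b])" and ?w2 = "walk_edges (b # C @ [c])"
  let ?w3 = "walk_edges (c # D @ [d])" and ?w4 = "walk_edges (d # F @ [a])"
  have dist: "distinct (a # B @ b # C @ c # D @ d # F)" using c by (simp add: cycle_in_def)
  have "walk_edges (d # F @ [a]) = walk_edges (d # F) \<union> {{last (d # F), a}}"
    using walk_edges_append[of "d # F" a "[]"] by simp
  then have w: "?w1 \<subseteq> E" "?w2 \<subseteq> E" "?w3 \<subseteq> E" "?w4 \<subseteq> E"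
    using c walk_edges_split[of a B b "C @ c # D @ d # F"] walk_edges_split[of b C c "D @ d # F"]
      walk_edges_split[of c D d F] by (auto simp: cycle_in_def)
  have e1: "walk_edges (a # (B @ b # C) @ [c]) = ?w1 \<union> ?w2"
    using walk_edges_split[of a B b "C @ [c]"] by simp
  have e2: "walk_edges (c # (D @ d # F) @ [a]) = ?w3 \<union> ?w4"
    using walk_edges_split[of c D d "F @ [a]"] by simp
  have e3: "walk_edges (b # (C @ c # D) @ [d]) = ?w2 \<union> ?w3"
    using walk_edges_split[of b C c "D @ [d]"] by simp
  have e4: "walk_edges (d # (F @ a # B) @ [b]) = ?w4 \<union> ?w1"
    using walk_edges_split[of d F a "B @ [b]"] by simp
  have p1: "path_in E a (B @ b # C) c" using e1 w dist by (auto simp: path_in_def)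
  have p2: "path_in E a (rev (D @ d # F)) c"
    using e2 w dist by (intro path_in_rev) (auto simp: path_in_def)
  have p3: "path_in E b (C @ c # D) d" using e3 w dist by (auto simp: path_in_def)
  have p4: "path_in E b (rev (F @ a # B)) d"
    using e4 w dist by (intro path_in_rev) (auto simp: path_in_def)
  have p5: "path_in E a [] c" "path_in E b [] d" using ac bd dist by (auto simp: path_in_def)
  let ?P1 = "trail (a # (B @ b # C) @ [c])" and ?P2 = "trail (a # rev (D @ d # F) @ [c])"
  let ?P3 = "trail (b # (C @ c # D) @ [d])" and ?P4 = "trail (b # rev (F @ a # B) @ [d])"
  let ?Q = "trail (a # [] @ [c])" and ?R = "trail (b # [] @ [d])"
  have i1: "?Q \<inter> inside (?P1 \<union> ?P2) \<noteq> {}"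
    using dist by (intro theta_path_inside(1)[OF p1 _ p2 _ p5(1)]) auto
  have i2: "?R \<inter> inside (?P3 \<union> ?P4) \<noteq> {}"
    using dist by (intro theta_path_inside(1)[OF p3 _ p4 _ p5(2)]) auto
  have r2: "walk_edges (a # rev (D @ d # F) @ [c]) = ?w3 \<union> ?w4"
    using walk_edges_rev[of "c # (D @ d # F) @ [a]"] e2 by simp
  have r4: "walk_edges (b # rev (F @ a # B) @ [d]) = ?w4 \<union> ?w1"
    using walk_edges_rev[of "d # (F @ a # B) @ [b]"] e4 by simp
  \<comment> \<open>The ends of either chord halve the cycle; both pairs of halves draw the same
    closed curve.\<close>
  have same: "?P1 \<union> ?P2 = ?P3 \<union> ?P4"
    unfolding trail_def e1 e3 r2 r4 by blast
  have "set (B @ b # C) \<inter> set (rev (D @ d # F)) = {}" using dist by auto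
  then have m: "?P1 \<inter> ?P2 = {p a, p c}" "?P1 \<inter> ?Q = {p a, p c}" "?P2 \<inter> ?Q = {p a, p c}"
    "?P3 \<inter> ?R = {p b, p d}" "?P4 \<inter> ?R = {p b, p d}"
    using paths_meet[OF p1 p2] paths_meet[OF p1 p5(1)] paths_meet[OF p2 p5(1)]
      paths_meet[OF p3 p5(2)] paths_meet[OF p4 p5(2)] by simp_all
  have QR: "?Q \<inter> ?R = {}"
    using trail_Int[of "a # [] @ [c]" "b # [] @ [d]"] ac bd dist by (auto simp: doubleton_eq_iff)
  have V: "a \<in> V" "b \<in> V" "c \<in> V" "d \<in> V" using edge_subset ac bd by auto
  have b1: "p b \<in> ?P1 - {p a, p c}" using trail_inner[OF p1, of b] p_eq_iff V dist by auto
  have d2: "p d \<in> ?P2 - {p a, p c}" using trail_inner[OF p2, of d] p_eq_iff V dist by auto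
  obtain g1 where g1: "arc g1" "pathstart g1 = p a" "pathfinish g1 = p c" "path_image g1 = ?P1"
    using path_arc[OF p1] by blast
  obtain g2 where g2: "arc g2" "pathstart g2 = p a" "pathfinish g2 = p c" "path_image g2 = ?P2"
    using path_arc[OF p2] by blast
  obtain g3 where g3: "arc g3" "pathstart g3 = p a" "pathfinish g3 = p c" "path_image g3 = ?Q"
    using path_arc[OF p5(1)] by blast
  obtain h where h: "arc h" "pathstart h = p b" "pathfinish h = p d" "path_image h = ?R"
    using path_arc[OF p5(2)] by blast
  have "(?P1 \<union> ?P2) \<inter> ?R = {p b, p d}" unfolding same using m(4,5) by blast
  then show False
    using crossing_arcs_not_inside[OF g1(1-3) g2(1-3) g3(1-3) _ _ _ h(1)] m(1-3) b1 d2 QR i1 i2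
    unfolding g1(4) g2(4) g3(4) h(2-4) same by blast
qed

lemma noncrossing_order_exists:
  assumes "two_connected V E"
  shows "\<exists>xs. cycle_in E xs \<and> set xs = V \<and> (\<forall>i j k l. i < j \<and> j < k \<and> k < l \<and> l < length xs \<and>
    {xs ! i, xs ! k} \<in> E \<longrightarrow> {xs ! j, xs ! l} \<notin> E)"
proof -
  obtain xs where xs: "cycle_in E xs" "set xs = V"
    using hamiltonian_cycle_exists[OF graph assms] theta_path_inside(2) by blast
  have "{xs ! j, xs ! l} \<notin> E" if h: "i < j" "j < k" "k < l" "l < length xs" "{xs ! i, xs ! k} \<in> E" for i j k l
  proof
    assume jl: "{xs ! j, xs ! l} \<in> E"
    \<comment> \<open>The list is cut at the four positions and then rotated to begin at
      \<open>xs ! i\<close>.\<close>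
    obtain A where "drop 0 xs = A @ xs ! i # drop (Suc i) xs" using drop_split[of 0 i xs] h by auto
    moreover obtain B where "drop (Suc i) xs = B @ xs ! j # drop (Suc j) xs" using drop_split[of "Suc i" j xs] h by auto
    moreover obtain C where "drop (Suc j) xs = C @ xs ! k # drop (Suc k) xs" using drop_split[of "Suc j" k xs] h by auto
    moreover obtain D where "drop (Suc k) xs = D @ xs ! l # drop (Suc l) xs" using drop_split[of "Suc k" l xs] h by auto
    ultimately have "xs = A @ xs ! i # (B @ xs ! j # C @ xs ! k # D @ xs ! l # drop (Suc l) xs)" by simp
    then have "cycle_in E (xs ! i # B @ xs ! j # C @ xs ! k # D @ xs ! l # (drop (Suc l) xs @ A))"
      using cycle_in_rotate[of E A "xs ! i" "B @ xs ! j # C @ xs ! k # D @ xs ! l # drop (Suc l) xs"] xs(1) by simp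
    then show False using cycle_chords_not_crossing h(5) jl by blast
  qed
  then show ?thesis using xs by blast
qed

end

section \<open>Relative positions of palettes and the transition tables\<close>

section \<open>Palettes\<close>

text \<open>Vertices of smaller degree also get five colours; the spare ones count as present when a
  colour is required to be missing.\<close>

definition palette :: "nat list \<Rightarrow> bool" where
  "palette A \<longleftrightarrow> length A = 5 \<and> distinct A \<and> set A \<subseteq> {..<9}"

text \<open>Both palettes are rotated so that the common edge of the two vertices has place 0.\<close>

definition fits :: "nat list \<Rightarrow> nat list \<Rightarrow> bool" where
  "fits A B \<longleftrightarrow> A ! 0 = B ! 0 \<and> A ! 1 \<notin> set B \<and> A ! 3 \<notin> set B \<and> B ! 1 \<notin> set A \<and> B ! 3 \<notin> set A"

text \<open>The possible palettes of the right end of a gap when the palette of the left end is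
  \<open>[0,1,2,3,4]\<close>, both rotated to start at the next place to be used in the gap. The list was found
  by a computer search for a set of patterns closed under the two kinds of steps below.\<close>

definition patterns :: "nat list list" where
  "patterns = [[5,6,3,4,7], [5,6,7,1,4], [5,6,7,3,4], [5,1,6,7,4], [5,3,6,7,4],
               [5,4,3,6,7], [5,1,2,6,7], [5,6,1,2,7], [5,3,6,7,2]]"

definition color_perm :: "nat list \<Rightarrow> bool" where
  "color_perm s \<longleftrightarrow> length s = 9 \<and> distinct s \<and> set s \<subseteq> {..<9}"

definition gap_state :: "nat list \<Rightarrow> nat list \<Rightarrow> bool" where
  "gap_state A B \<longleftrightarrow> (\<exists>k\<in>set patterns. \<exists>s. color_perm s \<and> A = map ((!) s) [0,1,2,3,4] \<and> B = map ((!) s) k)"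

text \<open>The only candidate for the permutation \<open>s\<close> in \<open>gap_state\<close>,
  given the pattern \<open>k\<close>: \<open>0\<close> to \<open>4\<close> go to \<open>A\<close>,
  the colours \<open>5\<close>, \<open>6\<close>, \<open>7\<close>, which occur in every pattern, go
  to the entries of \<open>B\<close> at the same places, and \<open>8\<close> goes to the colour
  left over. This makes the existence of \<open>s\<close> executable.\<close>

definition relabelling :: "nat list \<Rightarrow> nat list \<Rightarrow> nat list \<Rightarrow> nat list" where
  "relabelling A B k =
     A @ map (\<lambda>c. B ! length (takeWhile (\<lambda>d. d \<noteq> c) k)) [5,6,7] @ filter (\<lambda>c. c \<notin> set A \<and> c \<notin> set B) [0,1,2,3,4,5,6,7,8]"

definition gap_state_check :: "nat list \<Rightarrow> nat list \<Rightarrow> bool" where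
  "gap_state_check A B \<longleftrightarrow> list_ex (\<lambda>k. let s = relabelling A B k in
     length s = 9 \<and> distinct s \<and> list_all (\<lambda>c. c < 9) s \<and> A = map ((!) s) [0,1,2,3,4] \<and> B = map ((!) s) k) patterns"

text \<open>Rows are indexed by the patterns, columns by the number \<open>a\<close> of neighbours of the new vertex in
  the left one of the two new gaps. The new vertex has its left neighbour at place 0 and these \<open>a\<close>
  neighbours at the places \<open>1, \<dots>, a\<close>. In the closing case it is also adjacent to the right end of
  the gap, at place \<open>a + 1\<close>. The remaining places belong to the right new gap.\<close>

definition closing_table :: "nat list list list" where
  "closing_table =
  [[[0,5,2,7,8], [0,7,5,8,2], [0,8,7,5,2], [0,7,2,8,5]],
   [[0,5,2,7,8], [0,7,5,8,2], [0,8,7,5,2], [0,7,2,8,5]],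
   [[0,5,2,7,8], [0,7,5,8,2], [0,8,7,5,2], [0,7,2,8,5]],
   [[0,5,2,6,8], [0,6,5,8,2], [0,8,6,5,2], [0,6,2,8,5]],
   [[0,5,2,6,8], [0,6,5,8,2], [0,8,6,5,2], [0,6,2,8,5]],
   [[0,5,2,7,8], [0,7,5,8,2], [0,8,7,5,2], [0,7,2,8,5]],
   [[0,5,4,7,8], [0,7,5,8,4], [0,8,7,5,4], [0,7,4,8,5]],
   [[0,5,4,7,8], [0,7,5,8,4], [0,8,7,5,4], [0,7,4,8,5]],
   [[0,5,4,6,8], [0,6,5,8,4], [0,8,6,5,4], [0,6,4,8,5]]]"

definition branching_table :: "nat list list list" where
  "branching_table =
  [[[0,8,2,7,6], [0,7,2,6,8], [0,6,7,8,2], [0,7,6,8,2], [0,5,2,6,7]],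
   [[0,8,6,7,2], [0,8,2,6,7], [0,7,6,8,2], [0,8,7,6,2], [0,5,2,6,7]],
   [[0,8,6,7,2], [0,8,2,6,7], [0,7,6,8,2], [0,8,7,6,2], [0,5,2,6,7]],
   [[0,8,6,7,2], [0,8,2,6,7], [0,6,7,8,2], [0,8,6,7,2], [0,5,2,6,7]],
   [[0,8,6,7,2], [0,8,2,6,7], [0,6,7,8,2], [0,8,6,7,2], [0,5,2,6,7]],
   [[0,8,2,7,4], [0,7,2,6,8], [0,6,7,8,2], [0,8,6,7,2], [0,5,2,6,7]],
   [[0,8,2,6,4], [0,7,4,6,8], [0,6,7,8,4], [0,8,6,7,4], [0,5,2,6,7]],
   [[0,8,4,7,6], [0,7,4,6,8], [0,6,7,8,4], [0,7,6,8,4], [0,5,2,6,7]],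
   [[0,8,6,7,4], [0,8,4,6,7], [0,6,7,8,4], [0,8,6,7,4], [0,5,2,6,7]]]"

definition palette_check :: "nat list \<Rightarrow> bool" where
  "palette_check A \<longleftrightarrow> length A = 5 \<and> distinct A \<and> list_all (\<lambda>c. c < 9) A"

text \<open>Both ends of the gap spend their place 0 on the new vertex, hence \<open>rotate1\<close>
  in the new gaps. The new vertex serves the right gap from place \<open>a + 2\<close> on. For
  \<open>a = 0\<close> or \<open>a = 3\<close> it has no place for the left or the right gap, and
  nothing is demanded there.\<close>

definition closing_check :: "nat list \<Rightarrow> nat \<Rightarrow> nat list \<Rightarrow> bool" where
  "closing_check k a C \<longleftrightarrow> (let A = [0,1,2,3,4] in
     palette_check C \<and> fits A C \<and> fits k (rotate (a + 1) C) \<and>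
     (a = 0 \<or> gap_state_check (rotate1 A) (rotate1 C)) \<and>
     (a = 3 \<or> gap_state_check (rotate (a + 2) C) (rotate1 k)))"

text \<open>The new vertex is not joined to the right end, so \<open>k\<close> keeps its rotation
  and the right gap is served from place \<open>a + 1\<close> on.\<close>

definition branching_check :: "nat list \<Rightarrow> nat \<Rightarrow> nat list \<Rightarrow> bool" where
  "branching_check k a C \<longleftrightarrow> (let A = [0,1,2,3,4] in
     palette_check C \<and> fits A C \<and>
     (a = 0 \<or> gap_state_check (rotate1 A) (rotate1 C)) \<and>
     (a = 4 \<or> gap_state_check (rotate (a + 1) C) k))"

lemma closing_table_correct:
  "list_all2 (\<lambda>k row. list_all2 (closing_check k) [0,1,2,3] row) patterns closing_table"
  by code_simp

lemma branching_table_correct: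
  "list_all2 (\<lambda>k row. list_all2 (branching_check k) [0,1,2,3,4] row) patterns branching_table"
  by code_simp

lemma gap_state_checkD: "gap_state_check A B \<Longrightarrow> gap_state A B"
  unfolding gap_state_check_def gap_state_def color_perm_def Let_def list_ex_iff list_all_iff
  by blast

text \<open>Colour permutations compose. This carries the tables, made for the left palette
  \<open>[0,1,2,3,4]\<close>, over to arbitrary palettes.\<close>

lemma gap_state_relabel:
  assumes s: "color_perm s" and st: "gap_state A B"
  shows "gap_state (map ((!) s) A) (map ((!) s) B)"
proof -
  from st obtain k t where k: "k \<in> set patterns" and t: "color_perm t"
    and A: "A = map ((!) t) [0,1,2,3,4]" and B: "B = map ((!) t) k"
    unfolding gap_state_def by blast
  have k9: "set k \<subseteq> {..<9}" using k by (auto simp: patterns_def)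
  have lt: "\<And>c. c < 9 \<Longrightarrow> t ! c < 9"
    using t unfolding color_perm_def by (metis lessThan_iff nth_mem subsetD)
  have "color_perm (map ((!) s) t)"
    using s t unfolding color_perm_def
    by (auto simp: distinct_map inj_on_def nth_eq_iff_index_eq subset_iff)
  moreover have "map ((!) s) A = map ((!) (map ((!) s) t)) [0,1,2,3,4]"
    using t by (simp add: A color_perm_def)
  moreover have "map ((!) s) B = map ((!) (map ((!) s) t)) k"
    using t k9 by (auto simp: B color_perm_def)
  ultimately show ?thesis using k unfolding gap_state_def by blast
qed

lemma fits_relabel:
  assumes s: "color_perm s" and A: "set A \<subseteq> {..<9}" "length A = 5" and B: "set B \<subseteq> {..<9}" "length B = 5"
    and f: "fits A B"
  shows "fits (map ((!) s) A) (map ((!) s) B)"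
proof -
  have inj: "\<And>c d. c < 9 \<Longrightarrow> d < 9 \<Longrightarrow> s ! c = s ! d \<Longrightarrow> c = d"
    using s by (auto simp: color_perm_def nth_eq_iff_index_eq)
  have nA: "\<And>i. i < 5 \<Longrightarrow> A ! i < 9" and nB: "\<And>i. i < 5 \<Longrightarrow> B ! i < 9"
    using A B by (metis lessThan_iff nth_mem subsetD)+
  have mem: "s ! c \<in> (!) s ` X \<longleftrightarrow> c \<in> X" if "c < 9" "X \<subseteq> {..<9}" for c X
    using inj that by blast
  show ?thesis
    using f A(2) B(2) by (simp add: fits_def mem A(1) B(1) nA nB)
qed

lemma palette_relabel: "color_perm s \<Longrightarrow> palette A \<Longrightarrow> palette (map ((!) s) A)"
  unfolding palette_def color_perm_def
  by (auto simp: distinct_map inj_on_def nth_eq_iff_index_eq subset_iff)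

lemma palette_rotate [simp]: "palette (rotate m A) = palette A"
  by (simp add: palette_def)

lemma palette_check: "palette_check A \<longleftrightarrow> palette A"
  by (auto simp: palette_def palette_check_def list_all_iff)

lemma palette_base: "palette [0,1,2,3,4]"
  by (simp add: palette_def)

lemma palette_patterns: "k \<in> set patterns \<Longrightarrow> palette k"
  by (auto simp: patterns_def palette_def)

lemma closing_step:
  assumes "gap_state A B" and a: "a \<le> 3"
  shows "\<exists>C. palette C \<and> fits A C \<and> fits B (rotate (a + 1) C) \<and>
           (a = 0 \<or> gap_state (rotate1 A) (rotate1 C)) \<and>
           (a = 3 \<or> gap_state (rotate (a + 2) C) (rotate1 B))"
proof -
  from assms obtain k s where k: "k \<in> set patterns" and s: "color_perm s"
    and A: "A = map ((!) s) [0,1,2,3,4]" and B: "B = map ((!) s) k"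
    unfolding gap_state_def by blast
  from k obtain i where i: "i < length patterns" "patterns ! i = k" by (auto simp: in_set_conv_nth)
  \<comment> \<open>The entry is taken from the row of the pattern and column \<open>a\<close>;
    renaming by \<open>s\<close> then adapts it to \<open>A\<close> and \<open>B\<close>.\<close>
  define C where "C = closing_table ! i ! a"
  have "a < length [0,1,2,3::nat]" using a by simp
  moreover have "list_all2 (closing_check k) [0,1,2,3] (closing_table ! i)"
    using list_all2_nthD[OF closing_table_correct i(1)] i(2) by simp
  ultimately have "closing_check k ([0,1,2,3] ! a) C"
    unfolding C_def by (rule list_all2_nthD[rotated])
  moreover have "[0,1,2,3] ! a = a"
    using a by (auto simp: le_Suc_eq numeral_eq_Suc)
  ultimately have chk: "closing_check k a C" by simp
  let ?f = "map ((!) s)"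
  have pC: "palette C" and pk: "palette k"
    using chk palette_patterns[OF k] by (auto simp: closing_check_def Let_def palette_check)
  have "fits A (?f C)"
    unfolding A using chk pC s palette_base
    by (intro fits_relabel) (auto simp: closing_check_def palette_def)
  moreover have "fits B (rotate (a + 1) (?f C))"
    unfolding B rotate_map using chk pC pk s
    by (intro fits_relabel) (auto simp: closing_check_def palette_def)
  moreover have "a = 0 \<or> gap_state (rotate1 A) (rotate1 (?f C))"
  proof (cases "a = 0")
    case False
    then have "gap_state_check (rotate1 [0,1,2,3,4]) (rotate1 C)" using chk
      by (simp only: closing_check_def Let_def simp_thms)
    then show ?thesis unfolding A rotate1_map by (intro disjI2) (rule gap_state_relabel[OF s gap_state_checkD])
  qed simp
  moreover have "a = 3 \<or> gap_state (rotate (a + 2) (?f C)) (rotate1 B)"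
  proof (cases "a = 3")
    case False
    then have "gap_state_check (rotate (a + 2) C) (rotate1 k)" using chk
      by (simp only: closing_check_def Let_def simp_thms)
    then show ?thesis unfolding B rotate1_map rotate_map by (intro disjI2) (rule gap_state_relabel[OF s gap_state_checkD])
  qed simp
  ultimately show ?thesis using palette_relabel[OF s pC] by (intro exI[of _ "?f C"] conjI)
qed

lemma branching_step:
  assumes "gap_state A B" and a: "a \<le> 4"
  shows "\<exists>C. palette C \<and> fits A C \<and>
           (a = 0 \<or> gap_state (rotate1 A) (rotate1 C)) \<and>
           (a = 4 \<or> gap_state (rotate (a + 1) C) B)"
proof -
  from assms obtain k s where k: "k \<in> set patterns" and s: "color_perm s"
    and A: "A = map ((!) s) [0,1,2,3,4]" and B: "B = map ((!) s) k"
    unfolding gap_state_def by blast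
  from k obtain i where i: "i < length patterns" "patterns ! i = k" by (auto simp: in_set_conv_nth)
  define C where "C = branching_table ! i ! a"
  have "a < length [0,1,2,3,4::nat]" using a by simp
  moreover have "list_all2 (branching_check k) [0,1,2,3,4] (branching_table ! i)"
    using list_all2_nthD[OF branching_table_correct i(1)] i(2) by simp
  ultimately have "branching_check k ([0,1,2,3,4] ! a) C"
    unfolding C_def by (rule list_all2_nthD[rotated])
  moreover have "[0,1,2,3,4] ! a = a"
    using a by (auto simp: le_Suc_eq numeral_eq_Suc)
  ultimately have chk: "branching_check k a C" by simp
  let ?f = "map ((!) s)"
  have pC: "palette C"
    using chk by (auto simp: branching_check_def Let_def palette_check)
  have "fits A (?f C)"
    unfolding A using chk pC s palette_base
    by (intro fits_relabel) (auto simp: branching_check_def palette_def)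
  moreover have "a = 0 \<or> gap_state (rotate1 A) (rotate1 (?f C))"
  proof (cases "a = 0")
    case False
    then have "gap_state_check (rotate1 [0,1,2,3,4]) (rotate1 C)" using chk
      by (simp only: branching_check_def Let_def simp_thms)
    then show ?thesis unfolding A rotate1_map by (intro disjI2) (rule gap_state_relabel[OF s gap_state_checkD])
  qed simp
  moreover have "a = 4 \<or> gap_state (rotate (a + 1) (?f C)) B"
  proof (cases "a = 4")
    case False
    then have "gap_state_check (rotate (a + 1) C) k" using chk
      by (simp only: branching_check_def Let_def simp_thms)
    then show ?thesis unfolding B rotate_map by (intro disjI2) (rule gap_state_relabel[OF s gap_state_checkD])
  qed simp
  ultimately show ?thesis using palette_relabel[OF s pC] by (intro exI[of _ "?f C"] conjI)
qed

text \<open>\<open>A\<close> followed by the four other colours is a permutation, which can be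
  applied to any pattern. It provides a right palette for gaps whose right end imposes no
  condition.\<close>

lemma gap_state_exists:
  assumes "palette A"
  shows "\<exists>B. gap_state A B"
proof -
  define s where "s = A @ sorted_list_of_set ({..<9} - set A)"
  have "card ({..<9} - set A) = 4"
    using assms by (subst card_Diff_subset) (auto simp: palette_def distinct_card)
  then have "color_perm s"
    using assms by (auto simp: s_def color_perm_def palette_def)
  moreover have "A = map ((!) s) [0,1,2,3,4]"
  proof -
    have "[0,1,2,3,4] = [0..<length A]" using assms by (simp add: palette_def upt_rec)
    then show ?thesis by (auto simp: s_def nth_append intro!: nth_equalityI)
  qed
  moreover have "hd patterns \<in> set patterns" by (simp add: patterns_def)
  ultimately show ?thesis unfolding gap_state_def by blast
qed

section \<open>Choosing the palettes gap by gap\<close>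

section \<open>Noncrossing graphs on an interval\<close>

text \<open>With \<open>P\<close> the adjacency to an end of a gap, the ranks number its neighbours
  in the gap from 0: for the right end from the smallest upwards, and with \<open>rank_above\<close>
  for the left end from the largest downwards. A vertex splitting the gap thus comes first for
  either end.\<close>

definition rank_below :: "(nat \<Rightarrow> bool) \<Rightarrow> nat \<Rightarrow> nat \<Rightarrow> nat" where
  "rank_below P u x = card {y. u < y \<and> y < x \<and> P y}"

definition rank_above :: "(nat \<Rightarrow> bool) \<Rightarrow> nat \<Rightarrow> nat \<Rightarrow> nat" where
  "rank_above P v x = card {y. x < y \<and> y < v \<and> P y}"

lemma rank_below_less:
  assumes "P x" "u < x" "x < y"
  shows "rank_below P u x < rank_below P u y"
  unfolding rank_below_def
proof (rule psubset_card_mono)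
  show "finite {z. u < z \<and> z < y \<and> P z}" by (rule finite_subset[of _ "{..<y}"]) auto
  show "{z. u < z \<and> z < x \<and> P z} \<subset> {z. u < z \<and> z < y \<and> P z}"
    using assms by (auto intro: order.strict_trans)
qed

lemma rank_above_less:
  assumes "P y" "y < v" "x < y"
  shows "rank_above P v y < rank_above P v x"
  unfolding rank_above_def
proof (rule psubset_card_mono)
  show "finite {z. x < z \<and> z < v \<and> P z}" by (rule finite_subset[of _ "{..<v}"]) auto
  show "{z. y < z \<and> z < v \<and> P z} \<subset> {z. x < z \<and> z < v \<and> P z}"
    using assms by (auto intro: order.strict_trans)
qed

lemma rank_below_eqD:
  "rank_below P u x = rank_below P u y \<Longrightarrow> P x \<Longrightarrow> P y \<Longrightarrow> u < x \<Longrightarrow> u < y \<Longrightarrow> x = y"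
  by (metis less_irrefl linorder_neqE_nat rank_below_less)

lemma rank_above_eqD:
  "rank_above P v x = rank_above P v y \<Longrightarrow> P x \<Longrightarrow> P y \<Longrightarrow> x < v \<Longrightarrow> y < v \<Longrightarrow> x = y"
  by (metis less_irrefl linorder_neqE_nat rank_above_less)

text \<open>Passing to the gap that ends at \<open>w\<close> lowers the ranks by one, which is made
  up for by starting at place \<open>p + 1\<close> instead of \<open>p\<close>. The next lemma does
  this for the right end, where the shift depends on whether \<open>w\<close> is its
  neighbour.\<close>

lemma rank_above_split:
  assumes "x < w" "w < v" "P w" "\<And>y. w < y \<Longrightarrow> y < v \<Longrightarrow> \<not> P y"
  shows "rank_above P v x = Suc (rank_above P w x)"
proof -
  have "{y. x < y \<and> y < v \<and> P y} = insert w {y. x < y \<and> y < w \<and> P y}"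
  proof (rule set_eqI)
    fix y
    show "y \<in> {y. x < y \<and> y < v \<and> P y} \<longleftrightarrow> y \<in> insert w {y. x < y \<and> y < w \<and> P y}"
      using assms(1-3) assms(4)[of y] by (cases y w rule: linorder_cases) auto
  qed
  moreover have "finite {y. x < y \<and> y < w \<and> P y}" by (rule finite_subset[of _ "{..<w}"]) auto
  ultimately show ?thesis by (simp add: rank_above_def)
qed

lemma rank_below_split:
  assumes "u < w" "w < x" "\<And>y. u < y \<Longrightarrow> y < w \<Longrightarrow> \<not> P y"
  shows "rank_below P u x = (if P w then 1 else 0) + rank_below P w x"
proof -
  have "{y. u < y \<and> y < x \<and> P y} = (if P w then {w} else {}) \<union> {y. w < y \<and> y < x \<and> P y}"
  proof (rule set_eqI)
    fix y
    show "y \<in> {y. u < y \<and> y < x \<and> P y} \<longleftrightarrow> y \<in> (if P w then {w} else {}) \<union> {y. w < y \<and> y < x \<and> P y}"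
      using assms(1,2) assms(3)[of y] by (cases y w rule: linorder_cases) auto
  qed
  moreover have "finite {y. w < y \<and> y < x \<and> P y}" by (rule finite_subset[of _ "{..<x}"]) auto
  ultimately show ?thesis by (simp add: rank_below_def)
qed

lemma rank_below_first: "(\<And>y. u < y \<Longrightarrow> y < x \<Longrightarrow> \<not> P y) \<Longrightarrow> rank_below P u x = 0"
  unfolding rank_below_def by (metis (no_types, lifting) card.empty empty_Collect_eq)

lemma rank_above_first: "(\<And>y. x < y \<Longrightarrow> y < v \<Longrightarrow> \<not> P y) \<Longrightarrow> rank_above P v x = 0"
  unfolding rank_above_def by (metis (no_types, lifting) card.empty empty_Collect_eq)

text \<open>\<open>pos x y\<close> is the place of the edge to \<open>y\<close> in the palette of
  \<open>x\<close>; the rotation reads it modulo 5.\<close>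

definition matched :: "(nat \<Rightarrow> nat list) \<Rightarrow> (nat \<Rightarrow> nat \<Rightarrow> nat) \<Rightarrow> nat \<Rightarrow> nat \<Rightarrow> bool" where
  "matched pal pos x y \<longleftrightarrow> fits (rotate (pos x y) (pal x)) (rotate (pos y x) (pal y))"

lemma fits_sym: "fits A B \<Longrightarrow> fits B A"
  by (auto simp: fits_def)

lemma matched_sym: "matched pal pos x y \<Longrightarrow> matched pal pos y x"
  by (simp add: matched_def fits_sym)

locale noncrossing =
  fixes n :: nat and adj :: "nat \<Rightarrow> nat \<Rightarrow> bool"
  assumes adj_sym: "adj x y \<Longrightarrow> adj y x"
    and adj_less: "adj x y \<Longrightarrow> x < n"
    and adj_irrefl: "\<not> adj x x"
    and adj_Suc: "Suc x < n \<Longrightarrow> adj x (Suc x)"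
    and not_crossing: "i < j \<Longrightarrow> j < k \<Longrightarrow> k < l \<Longrightarrow> adj i k \<Longrightarrow> \<not> adj j l"
    and degree_le: "card {y. adj x y} \<le> 5"
begin

text \<open>The neighbours of \<open>u\<close> in the gap occupy consecutive places of \<open>A\<close> from \<open>p\<close> on, starting with the
  largest one; those of \<open>v\<close> occupy places of \<open>B\<close> from \<open>q\<close> on, starting with the smallest one. The
  palettes \<open>A\<close> and \<open>B\<close> of the ends are parameters, so that \<open>v\<close> may be the dummy vertex \<open>n\<close>.\<close>

definition gap_solution ::
  "nat \<Rightarrow> nat \<Rightarrow> nat list \<Rightarrow> nat \<Rightarrow> nat list \<Rightarrow> nat \<Rightarrow> (nat \<Rightarrow> nat list) \<Rightarrow> (nat \<Rightarrow> nat \<Rightarrow> nat) \<Rightarrow> bool" where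
  "gap_solution u v A p B q pal pos \<longleftrightarrow>
     (\<forall>x y. u < x \<and> x < v \<and> u < y \<and> y < v \<and> adj x y \<longrightarrow> matched pal pos x y) \<and>
     (\<forall>x. u < x \<and> x < v \<longrightarrow> palette (pal x) \<and>
        (\<forall>y z. adj x y \<and> adj x z \<and> pos x y mod 5 = pos x z mod 5 \<longrightarrow> y = z) \<and>
        (adj u x \<longrightarrow> fits (rotate (p + rank_above (adj u) v x) A) (rotate (pos x u) (pal x))) \<and>
        (adj v x \<longrightarrow> fits (rotate (q + rank_below (adj v) u x) B) (rotate (pos x v) (pal x))))"

lemma gap_solutionD:
  assumes "gap_solution u v A p B q pal pos" and "u < x" "x < v"
  shows "u < y \<Longrightarrow> y < v \<Longrightarrow> adj x y \<Longrightarrow> matched pal pos x y"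
    and "palette (pal x)"
    and "adj x y \<Longrightarrow> adj x z \<Longrightarrow> pos x y mod 5 = pos x z mod 5 \<Longrightarrow> y = z"
    and "adj u x \<Longrightarrow> fits (rotate (p + rank_above (adj u) v x) A) (rotate (pos x u) (pal x))"
    and "adj v x \<Longrightarrow> fits (rotate (q + rank_below (adj v) u x) B) (rotate (pos x v) (pal x))"
  using assms unfolding gap_solution_def by blast+

text \<open>Induction on the length of the gap, split at the largest neighbour \<open>w\<close> of
  \<open>u\<close>. A relative position of the end palettes is demanded only if both ends have
  neighbours in the gap, so the initial gap up to the dummy \<open>n\<close> needs none.\<close>

lemma gap_solution_exists:
  assumes "u < v" "v \<le> n" "palette A" "palette B"
    and "\<And>x z. u < x \<Longrightarrow> x < v \<Longrightarrow> adj x z \<Longrightarrow> u \<le> z \<and> z \<le> v"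
    and "\<And>x y. u < x \<Longrightarrow> x < v \<Longrightarrow> adj u x \<Longrightarrow> u < y \<Longrightarrow> y < v \<Longrightarrow> adj v y \<Longrightarrow>
           gap_state (rotate p A) (rotate q B)"
  shows "\<exists>pal pos. gap_solution u v A p B q pal pos"
  using assms
proof (induction "v - u" arbitrary: u v A p B q rule: less_induct)
  case less
  note closed = less.prems(5) and state = less.prems(6)
  show ?case
  proof (cases "v = Suc u")
    case True
    then have "gap_solution u v A p B q (\<lambda>_. []) (\<lambda>_ _. 0)" by (auto simp: gap_solution_def)
    then show ?thesis by blast
  next
    case False
    then have uv: "Suc u < v" using less.prems(1) by simp
    define w where "w = Max {x. u < x \<and> x < v \<and> adj u x}"
    have "finite {x. u < x \<and> x < v \<and> adj u x}" by (rule finite_subset[of _ "{..<v}"]) auto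
    moreover have "Suc u \<in> {x. u < x \<and> x < v \<and> adj u x}"
      using uv less.prems(2) adj_Suc by simp
    ultimately have "w \<in> {x. u < x \<and> x < v \<and> adj u x}"
      and wmax: "\<And>x. u < x \<Longrightarrow> x < v \<Longrightarrow> adj u x \<Longrightarrow> x \<le> w"
      unfolding w_def by (metis Max_in empty_iff, auto intro: Max_ge)
    then have uw: "u < w" and wv: "w < v" and auw: "adj u w" by auto
    have Pw: "\<not> adj u y" if "w < y" "y < v" for y using wmax[of y] that uw by auto
    \<comment> \<open>Such an edge would cross the edge from \<open>u\<close> to
      \<open>w\<close>.\<close>
    have Qw: "\<And>y. u < y \<Longrightarrow> y < w \<Longrightarrow> \<not> adj v y"
      using not_crossing[OF _ _ wv auw] adj_sym by blast
    define L where "L = {x. u < x \<and> x < w \<and> adj w x}"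
    define R where "R = {x. w < x \<and> x < v \<and> adj w x}"
    \<comment> \<open>Places at \<open>w\<close>: 0 for \<open>u\<close>, 1 to \<open>a\<close> for
      \<open>L\<close>, \<open>a + 1\<close> for \<open>v\<close> if adjacent, and from
      \<open>c\<close> on for \<open>R\<close>.\<close>
    define a where "a = card L"
    define e :: nat where "e = (if adj v w then 1 else 0)"
    define c where "c = a + 1 + e"
    have fin: "finite {y. adj w y}" "finite L" "finite R"
      using adj_less adj_sym by (auto intro!: finite_subset[of _ "{..<n}"] simp: L_def R_def)
    \<comment> \<open>The degree bound at \<open>w\<close> shows that five places are enough for
      this layout.\<close>
    have "card (insert u (L \<union> R \<union> (if adj v w then {v} else {}))) \<le> card {y. adj w y}"
      using auw fin by (intro card_mono) (auto simp: L_def R_def adj_sym)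
    also have "\<dots> \<le> 5" by (rule degree_le)
    finally have le5: "card (insert u (L \<union> R \<union> (if adj v w then {v} else {}))) \<le> 5" .
    have "card (insert u (L \<union> R \<union> (if adj v w then {v} else {}))) = Suc (card (L \<union> R \<union> (if adj v w then {v} else {})))"
      using fin uw wv by (subst card_insert_disjoint) (auto simp: L_def R_def)
    also have "card (L \<union> R \<union> (if adj v w then {v} else {})) = card (L \<union> R) + e"
      using fin uw wv by (subst card_Un_disjoint) (auto simp: L_def R_def e_def)
    also have "card (L \<union> R) = a + card R"
      using fin unfolding a_def by (subst card_Un_disjoint) (auto simp: L_def R_def)
    finally have deg: "c + card R \<le> 5" using le5 by (simp add: c_def)
    obtain C where C: "palette C" "fits (rotate p A) C"
      and Cv: "adj v w \<Longrightarrow> fits (rotate q B) (rotate (a + 1) C)"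
      and stL: "\<And>x. u < x \<Longrightarrow> x < w \<Longrightarrow> adj u x \<Longrightarrow> L \<noteq> {} \<Longrightarrow> gap_state (rotate (p + 1) A) (rotate 1 C)"
      and stR: "\<And>y. w < y \<Longrightarrow> y < v \<Longrightarrow> adj v y \<Longrightarrow> R \<noteq> {} \<Longrightarrow> gap_state (rotate c C) (rotate (q + e) B)"
    \<comment> \<open>If \<open>w\<close> is adjacent to \<open>v\<close>, its palette has to fit
      those of both ends; otherwise only that of \<open>u\<close>.\<close>
    proof (cases "adj v w")
      case True
      then have st: "gap_state (rotate p A) (rotate q B)" using state[OF uw wv auw uw wv] by simp
      have a3: "a \<le> 3" using deg True by (simp add: c_def e_def)
      from closing_step[OF st a3] obtain C where C: "palette C" "fits (rotate p A) C"
        "fits (rotate q B) (rotate (a + 1) C)"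
        "a = 0 \<or> gap_state (rotate1 (rotate p A)) (rotate1 C)"
        "a = 3 \<or> gap_state (rotate (a + 2) C) (rotate1 (rotate q B))" by blast
      show ?thesis
      proof (rule that[of C])
        fix x assume "L \<noteq> {}"
        then have "a \<noteq> 0" using fin by (simp add: a_def)
        then show "gap_state (rotate (p + 1) A) (rotate 1 C)" using C(4) by simp
      next
        fix y assume "R \<noteq> {}"
        then have "card R \<noteq> 0" using fin by simp
        \<comment> \<open>With \<open>a = 3\<close> all five places would be taken before
          \<open>R\<close>.\<close>
        then have "a \<noteq> 3" using deg True by (auto simp: c_def e_def)
        then show "gap_state (rotate c C) (rotate (q + e) B)"
          using C(5) True by (simp add: c_def e_def)
      qed (use C in auto)
    next
      case False
      \<comment> \<open>If \<open>v\<close> has no neighbour in the right gap, the hypotheses relate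
        \<open>A\<close> and \<open>B\<close> in no way. Any suitable \<open>B'\<close> can then
        stand in, since nothing there is compared with \<open>B\<close>.\<close>
      obtain B' where st: "gap_state (rotate p A) B'"
        and B': "\<And>y. w < y \<Longrightarrow> y < v \<Longrightarrow> adj v y \<Longrightarrow> B' = rotate q B"
      proof (cases "\<exists>y. w < y \<and> y < v \<and> adj v y")
        case True
        then obtain y where "w < y" "y < v" "adj v y" by blast
        then have "gap_state (rotate p A) (rotate q B)" using state[OF uw wv auw, of y] uw by simp
        then show ?thesis using that by blast
      next
        case False
        have "palette (rotate p A)" using less.prems(3) by simp
        then show ?thesis using gap_state_exists that False by blast
      qed
      have "a \<le> 4" using deg by (simp add: c_def)
      from branching_step[OF st this] obtain C where C: "palette C" "fits (rotate p A) C"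
        "a = 0 \<or> gap_state (rotate1 (rotate p A)) (rotate1 C)"
        "a = 4 \<or> gap_state (rotate (a + 1) C) B'" by blast
      show ?thesis
      proof (rule that[of C])
        fix x assume "L \<noteq> {}"
        then have "a \<noteq> 0" using fin by (simp add: a_def)
        then show "gap_state (rotate (p + 1) A) (rotate 1 C)" using C(3) by simp
      next
        fix y assume y: "w < y" "y < v" "adj v y" and "R \<noteq> {}"
        then have "card R \<noteq> 0" using fin by simp
        then have "a \<noteq> 4" using deg by (auto simp: c_def)
        then show "gap_state (rotate c C) (rotate (q + e) B)"
          using C(4) False B'[OF y] by (simp add: c_def e_def)
      qed (use C False in auto)
    qed
    \<comment> \<open>In the left gap, \<open>u\<close> has spent place \<open>p\<close> on
      \<open>w\<close>, and \<open>w\<close> is the right end, with places from 1 on.\<close>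
    have "\<exists>pal pos. gap_solution u w A (p + 1) C 1 pal pos"
    proof (rule less.hyps)
      fix x z assume x: "u < x" "x < w" "adj x z"
      then have "u \<le> z \<and> z \<le> v" using closed[of x z] wv by simp
      moreover have "\<not> w < z" using not_crossing[OF x(1,2) _ auw] x(3) by blast
      ultimately show "u \<le> z \<and> z \<le> w" by auto
    next
      fix x y assume "u < x" "x < w" "adj u x" "u < y" "y < w" "adj w y"
      then show "gap_state (rotate (p + 1) A) (rotate 1 C)" using stL by (auto simp: L_def)
    qed (use uw wv less.prems(1-4) C(1) in auto)
    then obtain pal1 pos1 where S1: "gap_solution u w A (p + 1) C 1 pal1 pos1" by blast
    \<comment> \<open>In the right gap, \<open>w\<close> is the left end, with places from
      \<open>c\<close> on, and \<open>v\<close> has spent \<open>e\<close> places on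
      \<open>w\<close>.\<close>
    have "\<exists>pal pos. gap_solution w v C c B (q + e) pal pos"
    proof (rule less.hyps)
      fix x z assume x: "w < x" "x < v" "adj x z"
      then have z: "u \<le> z \<and> z \<le> v" using closed[of x z] uw by simp
      have "z \<noteq> u" using Pw x adj_sym by blast
      moreover have "\<not> (u < z \<and> z < w)" using not_crossing[of u z w x] auw x adj_sym by blast
      ultimately show "w \<le> z \<and> z \<le> v" using z by auto
    next
      fix x y assume "w < x" "x < v" "adj w x" "w < y" "y < v" "adj v y"
      then show "gap_state (rotate c C) (rotate (q + e) B)" using stR by (auto simp: R_def)
    qed (use uw wv less.prems(1-4) C(1) in auto)
    then obtain pal2 pos2 where S2: "gap_solution w v C c B (q + e) pal2 pos2" by blast
    \<comment> \<open>The ranks agree with those that the two gap solutions prescribe for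
      \<open>w\<close> as an end.\<close>
    define posw where "posw = (\<lambda>z. if z = u then 0 else if z < w then 1 + rank_below (adj w) u z
        else if z = v then a + 1 else c + rank_above (adj w) v z)"
    define pal where "pal = (\<lambda>x. if x = w then C else if x < w then pal1 x else pal2 x)"
    define pos where "pos = (\<lambda>x. if x = w then posw else if x < w then pos1 x else pos2 x)"
    have left: "pal x = pal1 x" "pos x = pos1 x" if "x < w" for x using that by (auto simp: pal_def pos_def)
    have right: "pal x = pal2 x" "pos x = pos2 x" if "w < x" for x using that by (auto simp: pal_def pos_def)
    have mid: "pal w = C" "pos w = posw" by (auto simp: pal_def pos_def)
    have posw_u: "posw u = 0" and posw_v: "posw v = a + 1"
      using uw wv by (auto simp: posw_def)
    have posw_L: "posw z = 1 + rank_below (adj w) u z" if "u < z" "z < w" for z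
      using that by (auto simp: posw_def)
    have posw_R: "posw z = c + rank_above (adj w) v z" if "w < z" "z < v" for z
      using that uw by (auto simp: posw_def)
    have rank_L: "rank_below (adj w) u z < a" if "z \<in> L" for z
      using rank_below_less[of "adj w" z u w] that
      by (simp add: L_def a_def rank_below_def)
    have rank_R: "rank_above (adj w) v z < card R" if "z \<in> R" for z
      using rank_above_less[of "adj w" z v w] that
      by (simp add: R_def rank_above_def)
    have nbrs: "z = u \<or> z \<in> L \<or> (z = v \<and> e = 1) \<or> z \<in> R" if "adj w z" for z
    proof -
      have "u \<le> z" "z \<le> v" using closed[OF uw wv that] by auto
      moreover have "z \<noteq> w" using that adj_irrefl by metis
      ultimately consider "z = u" | "u < z" "z < w" | "w < z" "z < v" | "z = v"
        by (metis le_neq_implies_less linorder_neqE_nat)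
      then show ?thesis by cases (use that adj_sym[OF that] in \<open>auto simp: L_def R_def e_def\<close>)
    qed
    have posw_cases: "posw z < 5 \<and> (z = u \<and> posw z = 0 \<or> z \<in> L \<and> 0 < posw z \<and> posw z \<le> a \<or>
        z = v \<and> posw z = a + 1 \<and> c = a + 2 \<or> z \<in> R \<and> c \<le> posw z)" if "adj w z" for z
      using nbrs[OF that]
    proof (elim disjE conjE)
      assume z: "z \<in> L"
      then have "posw z = 1 + rank_below (adj w) u z" using posw_L by (simp add: L_def)
      then show ?thesis using z rank_L[OF z] deg by (simp add: c_def)
    next
      assume z: "z \<in> R"
      then have "posw z = c + rank_above (adj w) v z" using posw_R by (simp add: R_def)
      then show ?thesis using z rank_R[OF z] deg by simp
    qed (use posw_u posw_v deg in \<open>auto simp: c_def\<close>)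
    have inj_w: "y = z" if h: "adj w y" "adj w z" "posw y mod 5 = posw z mod 5" for y z
    proof -
      have eq: "posw y = posw z" using posw_cases[OF h(1)] posw_cases[OF h(2)] h(3) by simp
      have "c \<ge> a + 1" by (simp add: c_def)
      then consider "y = z" | "y \<in> L" "z \<in> L" | "y \<in> R" "z \<in> R"
        using posw_cases[OF h(1)] posw_cases[OF h(2)] eq by linarith
      then show ?thesis
      proof cases
        case 2
        then have "rank_below (adj w) u y = rank_below (adj w) u z"
          using eq posw_L by (simp add: L_def)
        then show ?thesis using 2 rank_below_eqD[of "adj w" u y z] by (simp add: L_def)
      next
        case 3
        then have "rank_above (adj w) v y = rank_above (adj w) v z"
          using eq posw_R by (simp add: R_def)
        then show ?thesis using 3 rank_above_eqD[of "adj w" v y z] by (simp add: R_def)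
      qed
    qed
    have match_L: "matched pal pos x w" if x: "u < x" "x < w" "adj x w" for x
    proof -
      have "adj w x" using x adj_sym by blast
      then have "fits (rotate (1 + rank_below (adj w) u x) C) (rotate (pos1 x w) (pal1 x))"
        using gap_solutionD(5)[OF S1] x by simp
      from fits_sym[OF this] show ?thesis
        using x by (simp add: matched_def left mid posw_L)
    qed
    have match_R: "matched pal pos x w" if x: "w < x" "x < v" "adj x w" for x
    proof -
      have "adj w x" using x adj_sym by blast
      then have "fits (rotate (c + rank_above (adj w) v x) C) (rotate (pos2 x w) (pal2 x))"
        using gap_solutionD(4)[OF S2] x by simp
      from fits_sym[OF this] show ?thesis
        using x by (simp add: matched_def right mid posw_R)
    qed
    have no_LR: "\<not> adj x y" if "u < x" "x < w" "w < y" for x y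
      using not_crossing[OF that(1,2,3) auw] .
    have "gap_solution u v A p B q pal pos"
      unfolding gap_solution_def
    proof (intro conjI allI impI; (elim conjE)?)
      fix x y assume h: "u < x" "x < v" "u < y" "y < v" "adj x y"
      consider "x = w" "y < w" | "x = w" "w < y" | "x < w" "y = w" | "w < x" "y = w"
        | "x < w" "y < w" | "w < x" "w < y" | "x < w" "w < y" | "w < x" "y < w"
        using adj_irrefl h(5) by (metis linorder_neqE_nat)
      then show "matched pal pos x y"
      proof cases
        case 1 then show ?thesis using match_L h adj_sym matched_sym by blast
      next
        case 2 then show ?thesis using match_R h adj_sym matched_sym by blast
      next
        case 3 then show ?thesis using match_L h by blast
      next
        case 4 then show ?thesis using match_R h by blast
      next
        case 5
        then have "matched pal1 pos1 x y" using gap_solutionD(1)[OF S1] h by simp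
        then show ?thesis using 5 by (simp add: matched_def left)
      next
        case 6
        then have "matched pal2 pos2 x y" using gap_solutionD(1)[OF S2] h by simp
        then show ?thesis using 6 by (simp add: matched_def right)
      next
        case 7 then show ?thesis using no_LR h by blast
      next
        case 8 then show ?thesis using no_LR h adj_sym by blast
      qed
    next
      fix x assume h: "u < x" "x < v"
      consider "x = w" | "x < w" | "w < x" by (metis linorder_neqE_nat)
      note cases = this
      show "palette (pal x)"
        using cases gap_solutionD(2)[OF S1] gap_solutionD(2)[OF S2] h C(1) by cases (simp_all add: left right mid)
      show "fits (rotate (p + rank_above (adj u) v x) A) (rotate (pos x u) (pal x))" if ax: "adj u x"
      proof -
        consider "x = w" | "x < w" using Pw h ax by (metis linorder_neqE_nat)
        then show ?thesis
        proof cases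
          case 1
          have "rank_above (adj u) v w = 0" using Pw by (intro rank_above_first)
          then show ?thesis using C(2) 1 by (simp add: mid posw_u)
        next
          case 2
          have "rank_above (adj u) v x = Suc (rank_above (adj u) w x)"
            using 2 wv auw Pw by (intro rank_above_split)
          moreover have "fits (rotate (p + 1 + rank_above (adj u) w x) A) (rotate (pos1 x u) (pal1 x))"
            using gap_solutionD(4)[OF S1] h 2 ax by simp
          ultimately show ?thesis using 2 by (simp add: left)
        qed
      qed
      show "fits (rotate (q + rank_below (adj v) u x) B) (rotate (pos x v) (pal x))" if ax: "adj v x"
      proof -
        consider "x = w" | "w < x" using Qw h ax by (metis linorder_neqE_nat)
        then show ?thesis
        proof cases
          case 1
          have "rank_below (adj v) u w = 0" using Qw by (intro rank_below_first)
          then show ?thesis using Cv ax 1 by (simp add: mid posw_v)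
        next
          case 2
          have "rank_below (adj v) u x = e + rank_below (adj v) w x"
            unfolding e_def using 2 uw Qw by (intro rank_below_split)
          moreover have "fits (rotate (q + e + rank_below (adj v) w x) B) (rotate (pos2 x v) (pal2 x))"
            using gap_solutionD(5)[OF S2] h 2 ax by simp
          ultimately show ?thesis using 2 by (simp add: right add.assoc)
        qed
      qed
    next
      fix x y z assume h: "u < x" "x < v" "adj x y" "adj x z" "pos x y mod 5 = pos x z mod 5"
      consider "x = w" | "x < w" | "w < x" by (metis linorder_neqE_nat)
      then show "y = z"
      proof cases
        case 1 then show ?thesis using inj_w h by (simp add: mid)
      next
        case 2 then show ?thesis using gap_solutionD(3)[OF S1, of x y z] h by (simp add: left)
      next
        case 3 then show ?thesis using gap_solutionD(3)[OF S2, of x y z] h by (simp add: right)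
      qed
    qed
    then show ?thesis by (intro exI)
  qed
qed

lemma palettes_exist:
  assumes "0 < n"
  shows "\<exists>pal pos. (\<forall>x<n. palette (pal x)) \<and>
     (\<forall>x y z. adj x y \<and> adj x z \<and> pos x y mod 5 = pos x z mod 5 \<longrightarrow> y = z) \<and>
     (\<forall>x y. adj x y \<longrightarrow> matched pal pos x y)"
proof -
  let ?A = "[0,1,2,3,4::nat]"
  have nbr: "\<And>x y. adj x y \<Longrightarrow> x < n \<and> y < n" using adj_less adj_sym by blast
  have "\<exists>pal pos. gap_solution 0 n ?A 0 ?A 0 pal pos"
  proof (rule gap_solution_exists)
    fix x z assume "adj x z"
    then show "0 \<le> z \<and> z \<le> n" using nbr by (simp add: less_imp_le)
  next
    fix y assume "adj n y"
    then show "gap_state (rotate 0 ?A) (rotate 0 ?A)" using nbr by blast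
  qed (use assms palette_base in simp_all)
  then obtain pal pos where S: "gap_solution 0 n ?A 0 ?A 0 pal pos" by blast
  define pal' where "pal' = pal(0 := ?A)"
  define pos' where "pos' = pos(0 := rank_above (adj 0) n)"
  have root: "matched pal' pos' 0 x" if "adj 0 x" for x
  proof -
    have x: "0 < x" "x < n" using that nbr adj_irrefl by (metis gr0I)+
    then have "fits (rotate (0 + rank_above (adj 0) n x) ?A) (rotate (pos x 0) (pal x))"
      using gap_solutionD(4)[OF S x that] by simp
    then show ?thesis using x by (simp add: matched_def pal'_def pos'_def)
  qed
  have lt5: "rank_above (adj 0) n x < 5" if "adj 0 x" for x
  proof -
    have x: "0 < x" "x < n" using that nbr adj_irrefl by (metis gr0I)+
    have "rank_above (adj 0) n x < rank_above (adj 0) n 0"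
      using that x by (intro rank_above_less)
    also have "\<dots> \<le> card {y. adj 0 y}"
      unfolding rank_above_def
    proof (rule card_mono)
      have "{y. adj 0 y} \<subseteq> {..<n}" using nbr by blast
      then show "finite {y. adj 0 y}" by (rule finite_subset) simp
    qed blast
    also have "\<dots> \<le> 5" by (rule degree_le)
    finally show ?thesis .
  qed
  have "palette (pal' x)" if "x < n" for x
    using gap_solutionD(2)[OF S, of x] that palette_base by (cases "x = 0") (auto simp: pal'_def)
  moreover have "y = z" if "adj x y" "adj x z" "pos' x y mod 5 = pos' x z mod 5" for x y z
  proof (cases "x = 0")
    case True
    then have "rank_above (adj 0) n y = rank_above (adj 0) n z"
      using that lt5 by (simp add: pos'_def)
    then show ?thesis using that True nbr rank_above_eqD by blast
  next
    case False
    then have "pos' x = pos x" by (simp add: pos'_def)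
    then show ?thesis
      using gap_solutionD(3)[OF S _ _ that(1,2)] that(3) nbr[OF that(1)] False by simp
  qed
  moreover have "matched pal' pos' x y" if "adj x y" for x y
  proof -
    consider "x = 0" | "y = 0" | "0 < x" "0 < y" by auto
    then show ?thesis
    proof cases
      case 1 then show ?thesis using root that by blast
    next
      case 2 then show ?thesis using root that adj_sym matched_sym by blast
    next
      case 3
      then have "matched pal pos x y" using gap_solutionD(1)[OF S, of x y] that nbr[OF that] by simp
      then show ?thesis using 3 by (simp add: matched_def pal'_def pos'_def)
    qed
  qed
  ultimately show ?thesis by blast
qed

end

section \<open>Star edge colourings from palettes\<close>

lemma star_coloring_of_palettes:
  fixes E :: "'a set set" and pal :: "'a \<Rightarrow> nat list" and pos :: "'a \<Rightarrow> 'a \<Rightarrow> nat"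
  assumes card2: "\<And>e. e \<in> E \<Longrightarrow> card e = 2"
    and pal: "\<And>x y. {x, y} \<in> E \<Longrightarrow> palette (pal x)"
    and fit: "\<And>x y. {x, y} \<in> E \<Longrightarrow> fits (rotate (pos x y) (pal x)) (rotate (pos y x) (pal y))"
    and inj: "\<And>x y z. {x, y} \<in> E \<Longrightarrow> {x, z} \<in> E \<Longrightarrow> pos x y mod 5 = pos x z mod 5 \<Longrightarrow> y = z"
  shows "\<exists>c. star_edge_coloring E c \<and> c ` E \<subseteq> {..<9}"
proof -
  define col where "col x y = pal x ! (pos x y mod 5)" for x y
  have rot: "rotate m (pal x) ! i = pal x ! ((m + i) mod 5)" if "{x, y} \<in> E" "i < 5" for m i x y
    using pal[OF that(1)] that(2) by (simp add: nth_rotate palette_def)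
  have E_sym: "{x, y} \<in> E \<Longrightarrow> {y, x} \<in> E" for x y by (simp add: insert_commute)
  have sym: "col x y = col y x" if "{x, y} \<in> E" for x y
    using fit[OF that] rot[OF that, of 0] rot[OF E_sym[OF that], of 0] by (simp add: fits_def col_def)
  have col_mem: "col x y \<in> set (pal x)" if "{x, y} \<in> E" for x y
    using pal[OF that] by (simp add: col_def palette_def)
  have col_inj: "y = z" if "{x, y} \<in> E" "{x, z} \<in> E" "col x y = col x z" for x y z
    using that pal[OF that(1)] inj[OF that(1,2)] by (simp add: col_def palette_def nth_eq_iff_index_eq)
  have avoid: "col u y \<notin> set (pal x)"
    if "{u, x} \<in> E" "d = 1 \<or> d = 3" "pos u y mod 5 = (pos u x + d) mod 5" for u x y d
    using fit[OF that(1)] rot[OF that(1), of d "pos u x"] that(2,3)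
    by (auto simp: fits_def col_def)
  define c where "c e = (THE k. \<exists>x y. e = {x, y} \<and> k = col x y)" for e
  have c: "c {x, y} = col x y" if "{x, y} \<in> E" for x y
    unfolding c_def using sym[OF that] by (intro the_equality) (auto simp: doubleton_eq_iff)
  have proper: "c {u, x} \<noteq> c {u, y}" if "{u, x} \<in> E" "{u, y} \<in> E" "x \<noteq> y" for u x y
    using col_inj that c by metis
  have tournament: "\<not> (col u x \<in> set (pal y) \<and> col u y \<in> set (pal x))"
    if ux: "{u, x} \<in> E" and uy: "{u, y} \<in> E" and ne: "x \<noteq> y" for u x y
  proof -
    define i j where "i = pos u x mod 5" and "j = pos u y mod 5"
    have "i \<noteq> j" using inj[OF ux uy] ne by (auto simp: i_def j_def)
    moreover have "i = 0 \<or> i = 1 \<or> i = 2 \<or> i = 3 \<or> i = 4" "j = 0 \<or> j = 1 \<or> j = 2 \<or> j = 3 \<or> j = 4"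
      using mod_less_divisor[of 5 "pos u x"] mod_less_divisor[of 5 "pos u y"]
      unfolding i_def j_def by linarith+
    ultimately have "j = (i + 1) mod 5 \<or> j = (i + 3) mod 5 \<or> i = (j + 1) mod 5 \<or> i = (j + 3) mod 5"
      by (elim disjE) simp_all
    then have "j = (pos u x + 1) mod 5 \<or> j = (pos u x + 3) mod 5 \<or>
        i = (pos u y + 1) mod 5 \<or> i = (pos u y + 3) mod 5"
      unfolding i_def j_def by (simp only: mod_add_left_eq)
    then show ?thesis using avoid[OF ux] avoid[OF uy] unfolding i_def j_def by blast
  qed
  have "star_edge_coloring E c"
    unfolding star_edge_coloring_def
  proof (intro conjI ballI allI impI; (elim conjE)?)
    fix e f assume ef: "e \<in> E" "f \<in> E" "e \<noteq> f" "e \<inter> f \<noteq> {}"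
    then obtain u where "u \<in> e" "u \<in> f" by blast
    moreover obtain a b where "e = {a, b}" using card2[OF ef(1)] by (meson card_2_iff)
    moreover obtain a' b' where "f = {a', b'}" using card2[OF ef(2)] by (meson card_2_iff)
    ultimately obtain x y where "e = {u, x}" "f = {u, y}" by (auto simp: doubleton_eq_iff)
    then show "c e \<noteq> c f" using proper ef by blast
  next
    fix v0 v1 v2 v3 v4
    assume E: "{v0, v1} \<in> E" "{v1, v2} \<in> E" "{v2, v3} \<in> E" "{v3, v4} \<in> E"
      and d: "distinct [v0, v1, v2, v3]" "distinct [v1, v2, v3, v4]"
    have n: "c {v0, v1} \<noteq> c {v1, v2}" "c {v1, v2} \<noteq> c {v2, v3}" "c {v2, v3} \<noteq> c {v3, v4}"
      using proper[of v1 v0 v2] proper[of v2 v1 v3] proper[of v3 v2 v4] E d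
      by (auto simp: insert_commute)
    have "\<not> (c {v0, v1} = c {v2, v3} \<and> c {v1, v2} = c {v3, v4})"
    proof
      assume eq: "c {v0, v1} = c {v2, v3} \<and> c {v1, v2} = c {v3, v4}"
      have "col v2 v3 \<in> set (pal v1)"
        using eq c[OF E(1)] c[OF E(3)] sym[OF E(1)] col_mem[OF E_sym[OF E(1)]] by metis
      moreover have "col v2 v1 \<in> set (pal v3)"
        using eq c[OF E(2)] c[OF E(4)] sym[OF E(2)] col_mem[OF E(4)] by metis
      ultimately show False using tournament[OF E_sym[OF E(2)] E(3)] d by simp
    qed
    then show "2 < card {c {v0, v1}, c {v1, v2}, c {v2, v3}, c {v3, v4}}"
      using n by (auto simp: card_insert_if)
  qed
  moreover have "c ` E \<subseteq> {..<9}"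
  proof
    fix k assume "k \<in> c ` E"
    then obtain e where e: "e \<in> E" "k = c e" by blast
    obtain a b where "e = {a, b}" using card2[OF e(1)] by (meson card_2_iff)
    then show "k \<in> {..<9}" using e c[of a b] col_mem[of a b] pal[of a b] by (auto simp: palette_def)
  qed
  ultimately show ?thesis by blast
qed

lemma star_coloring_of_noncrossing_order:
  fixes V :: "'a set" and E :: "'a set set" and xs :: "'a list"
  assumes G: "simple_graph V E" and xs: "distinct xs" "set xs = V" "xs \<noteq> []"
    and path: "\<And>i. Suc i < length xs \<Longrightarrow> {xs ! i, xs ! Suc i} \<in> E"
    and nc: "\<And>i j k l. i < j \<Longrightarrow> j < k \<Longrightarrow> k < l \<Longrightarrow> l < length xs \<Longrightarrow>
        {xs ! i, xs ! k} \<in> E \<Longrightarrow> {xs ! j, xs ! l} \<notin> E"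
    and deg: "\<And>v. v \<in> V \<Longrightarrow> degree E v \<le> 5"
  shows "\<exists>c. star_edge_coloring E c \<and> c ` E \<subseteq> {..<9}"
proof -
  define n where "n = length xs"
  define adj where "adj i j \<longleftrightarrow> i < n \<and> j < n \<and> {xs ! i, xs ! j} \<in> E" for i j
  have card2: "card e = 2" "e \<subseteq> V" if "e \<in> E" for e using G that by (auto simp: simple_graph_def)
  interpret noncrossing n adj
  proof
    fix x y show "adj x y \<Longrightarrow> adj y x" by (simp add: adj_def insert_commute)
    show "adj x y \<Longrightarrow> x < n" by (simp add: adj_def)
    show "\<not> adj x x" using card2(1)[of "{xs ! x, xs ! x}"] by (auto simp: adj_def)
    show "Suc x < n \<Longrightarrow> adj x (Suc x)" using path by (simp add: adj_def n_def)
  next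
    fix i j k l :: nat assume "i < j" "j < k" "k < l" "adj i k"
    then show "\<not> adj j l" using nc[of i j k l] by (auto simp: adj_def n_def)
  next
    fix x show "card {y. adj x y} \<le> 5"
    proof (cases "x < n")
      case True
      have "finite E"
        using G unfolding simple_graph_def by (metis Pow_iff finite_Pow_iff finite_subset subsetI)
      then have "card {y. adj x y} \<le> degree E (xs ! x)"
        unfolding degree_def
        by (intro card_inj_on_le[of "\<lambda>y. {xs ! x, xs ! y}"])
          (auto simp: inj_on_def doubleton_eq_iff adj_def n_def nth_eq_iff_index_eq xs(1))
      also have "\<dots> \<le> 5" using deg True xs(2) by (auto simp: n_def)
      finally show ?thesis .
    qed (simp add: adj_def)
  qed
  obtain pal pos where P: "\<And>x. x < n \<Longrightarrow> palette (pal x)"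
    "\<And>x y z. adj x y \<Longrightarrow> adj x z \<Longrightarrow> pos x y mod 5 = pos x z mod 5 \<Longrightarrow> y = z"
    "\<And>x y. adj x y \<Longrightarrow> matched pal pos x y"
    using palettes_exist xs(3) unfolding n_def by blast
  define idx where "idx v = (THE i. i < n \<and> xs ! i = v)" for v
  have idx: "idx v < n \<and> xs ! idx v = v" if "v \<in> V" for v
  proof -
    have "v \<in> set xs" using that xs(2) by simp
    then obtain i where i: "i < n" "xs ! i = v" unfolding n_def by (metis in_set_conv_nth)
    have "\<exists>!i. i < n \<and> xs ! i = v"
    proof (rule ex1I[of _ i])
      fix j assume "j < n \<and> xs ! j = v"
      then show "j = i" using i nth_eq_iff_index_eq[OF xs(1), of j i] by (simp add: n_def)
    qed (use i in simp)
    then show ?thesis unfolding idx_def by (rule theI')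
  qed
  have adj_idx: "adj (idx x) (idx y)" if "{x, y} \<in> E" for x y
    using idx[of x] idx[of y] card2(2)[OF that] that by (simp add: adj_def)
  show ?thesis
  proof (rule star_coloring_of_palettes[of E "\<lambda>x. pal (idx x)" "\<lambda>x y. pos (idx x) (idx y)"])
    fix x y assume e: "{x, y} \<in> E"
    then show "palette (pal (idx x))" using P(1) adj_idx adj_less by blast
    show "fits (rotate (pos (idx x) (idx y)) (pal (idx x))) (rotate (pos (idx y) (idx x)) (pal (idx y)))"
      using P(3)[OF adj_idx[OF e]] by (simp add: matched_def)
    fix z assume e': "{x, z} \<in> E" and "pos (idx x) (idx y) mod 5 = pos (idx x) (idx z) mod 5"
    then have "idx y = idx z" using P(2)[OF adj_idx[OF e] adj_idx[OF e']] by blast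
    then show "y = z" using idx card2(2)[OF e] card2(2)[OF e'] by (metis insert_subset)
  qed (use card2 in auto)
qed

theorem theorem4p1:
  fixes V :: "'a set" and E :: "'a set set"
  assumes "simple_graph V E"
    and "two_connected V E"
    and "outerplanar V E"
    and "max_degree V E = 5"
  shows "star_chromatic_index E \<le> nat \<lfloor>1.5 * real (max_degree V E)\<rfloor> + 2 \<and>
         star_chromatic_index E \<le> 9"
proof -
  obtain p \<gamma> where "outerplanar_drawing V E p \<gamma>" using assms(3) by (auto simp: outerplanar_def)
  then interpret drawing V E p \<gamma> using assms(1) by unfold_locales
  from noncrossing_order_exists[OF assms(2)] obtain xs where xs: "cycle_in E xs" "set xs = V"
    and nc: "\<forall>i j k l. i < j \<and> j < k \<and> k < l \<and> l < length xs \<and> {xs ! i, xs ! k} \<in> E \<longrightarrow> {xs ! j, xs ! l} \<notin> E"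
    by (elim exE conjE)
  have "finite V" using assms(1) by (simp add: simple_graph_def)
  then have deg: "degree E v \<le> 5" if "v \<in> V" for v
    using that assms(4) Max_ge[of "degree E ` V" "degree E v"] by (simp add: max_degree_def)
  have "\<exists>c. star_edge_coloring E c \<and> c ` E \<subseteq> {..<9}"
  proof (rule star_coloring_of_noncrossing_order[OF assms(1) _ xs(2)])
    show "distinct xs" "xs \<noteq> []" using xs(1) by (auto simp: cycle_in_def)
    show "{xs ! i, xs ! Suc i} \<in> E" if "Suc i < length xs" for i
      using walk_edges_nth[OF that] xs(1) by (auto simp: cycle_in_def)
    show "{xs ! j, xs ! l} \<notin> E"
      if "i < j" "j < k" "k < l" "l < length xs" "{xs ! i, xs ! k} \<in> E" for i j k l
      using nc that by blast
  qed (rule deg)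
  then obtain c where c: "star_edge_coloring E c" "c ` E \<subseteq> {..<9}" by blast
  have "card (c ` E) \<le> 9" using card_mono[OF _ c(2)] by simp
  then have "star_chromatic_index E \<le> 9"
    unfolding star_chromatic_index_def using c(1) by (intro Least_le) blast
  then show ?thesis using assms(4) by simp
qed

end
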